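(* Given a $(g,m_0,m_1)$-action on $\mathbb S^{n+1}$ with $n=\frac{m_0+m_1}{2}g$, and an integer $k$ of the form $k=jg+1$ with $j\in\mathbb Z$, the $k$-map is harmonic if and only if $k=1$, or ($g=2$ and $k=-1$), or ($m_0=m_1$ and $k=1-g$).
   Context: A $(g,m_0,m_1)$-action on $\mathbb S^{n+1}$ is an isometric action of a compact Lie group $G$ on the unit sphere $\mathbb S^{n+1}$ of cohomogeneity one whose principal orbits have $g$ distinct principal curvatures with multiplicities $m_0,\dots,m_{g-1}$, where $m_i$ depends only on the parity of $i$ (so $m_0=m_2=\dots$, $m_1=m_3=\dots$, and $m_0=m_1$ if $g$ is odd). A normal geodesic is a unit-speed geodesic $\gamma$ meeting all orbits perpendicularly with $\gamma(0)$ in a non-principal orbit; the orbit space is $[0,\pi/g]$, the non-principal isotropy groups $K_i$ occur at $\gamma(i\pi/g)$, and with $H$ the principal isotropy group along $\gamma$, $m_i=\dim K_i/H$. Up to ordering of $m_0,m_1$ the possible data are $(1,m,m)$, $(2,m_0,m_1)$, $(3,1,1)$, $(3,2,2)$, $(3,4,4)$, $(3,8,8)$, $(4,m_0,1)$, $(4,2,2)$, $(4,2,2\ell+1)$, $(4,4,4\ell+3)$, $(4,4,5)$, $(4,6,9)$, $(6,1,1)$, $(6,2,2)$. The Weyl group is dihedral of order $2g$, and for every integer $k=jg+1$, $j\in\mathbb Z$, the $k$-map is the well-defined smooth self-map $a\cdot\gamma(t)\mapsto a\cdot\gamma(kt)$ ($a\in G$) of $\mathbb S^{n+1}$. Harmonic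 means that the tension field vanishes.
   Formalization: The case g=1, k=-1 is excluded: there the k-map is always harmonic (e.g. for SO(n+1) fixing two poles it is the isometry (x_0,x) -> (x_0,-x)), although none of the three listed alternatives holds, so the claim as stated fails exactly there. *)

theory Defs
  imports "HOL-Analysis.Analysis" "HOL-Algebra.Group_Action"
begin

section \<open>Smooth maps and compact Lie groups\<close>

text \<open>\<open>Ck_on k f S\<close>: \<open>f\<close> is of class \<open>C\<^sup>k\<close> on the open subset \<open>S\<close> of a Euclidean space.\<close>

primrec Ck_on :: "nat \<Rightarrow> ('a::euclidean_space \<Rightarrow> 'b::euclidean_space) \<Rightarrow> 'a set \<Rightarrow> bool" where
  "Ck_on 0 f S \<longleftrightarrow> continuous_on S f"
| "Ck_on (Suc k) f S \<longleftrightarrow> (\<forall>x\<in>S. f differentiable (at x)) \<and>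
     (\<forall>v. Ck_on k (\<lambda>x. frechet_derivative f (at x) v) S)"

definition smooth_on :: "'a::euclidean_space set \<Rightarrow> ('a \<Rightarrow> 'b::euclidean_space) \<Rightarrow> bool" where
  "smooth_on S f \<longleftrightarrow> open S \<and> (\<forall>k. Ck_on k f S)"

text \<open>A compact Lie group: a compact Hausdorff topological group with a smooth atlas \<open>A\<close> (pairs of a
  chart domain and a chart into the model space \<open>'e\<close>) for which the group operations are smooth.
  Second countability follows from compactness.  Since \<open>'e\<close> has positive dimension, finite groups
  are left out; they have no orbits of positive dimension.\<close>

definition compact_lie_group ::
  "('g, 'r) monoid_scheme \<Rightarrow> 'g topology \<Rightarrow> ('g set \<times> ('g \<Rightarrow> 'e::euclidean_space)) set \<Rightarrow> bool" where
  "compact_lie_group G T A \<longleftrightarrow>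
     group G \<and> topspace T = carrier G \<and> compact_space T \<and> Hausdorff_space T \<and>
     continuous_map (prod_topology T T) T (\<lambda>(a, b). a \<otimes>\<^bsub>G\<^esub> b) \<and>
     continuous_map T T (\<lambda>a. inv\<^bsub>G\<^esub> a) \<and>
     (\<Union>(U, \<phi>)\<in>A. U) = carrier G \<and>
     (\<forall>(U, \<phi>)\<in>A. openin T U \<and> open (\<phi> ` U) \<and>
        homeomorphic_map (subtopology T U) (top_of_set (\<phi> ` U)) \<phi>) \<and>
     (\<forall>(U, \<phi>)\<in>A. \<forall>(W, \<psi>)\<in>A.
        smooth_on (\<phi> ` (U \<inter> W)) (\<lambda>u. \<psi> (inv_into U \<phi> u))) \<and>
     (\<forall>(U, \<phi>)\<in>A. \<forall>(W, \<psi>)\<in>A. \<forall>(Z, \<zeta>)\<in>A.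
        smooth_on {(\<phi> a, \<psi> b) |a b. a \<in> U \<and> b \<in> W \<and> a \<otimes>\<^bsub>G\<^esub> b \<in> Z}
          (\<lambda>(u, w). \<zeta> (inv_into U \<phi> u \<otimes>\<^bsub>G\<^esub> inv_into W \<psi> w))) \<and>
     (\<forall>(U, \<phi>)\<in>A. \<forall>(W, \<psi>)\<in>A.
        smooth_on (\<phi> ` {a \<in> U. inv\<^bsub>G\<^esub> a \<in> W}) (\<lambda>u. \<psi> (inv\<^bsub>G\<^esub> (inv_into U \<phi> u))))"


section \<open>Calculus on the unit sphere\<close>

text \<open>The sphere is \<open>sphere 0 1\<close> in a Euclidean space; its tangent space at \<open>x\<close> is the orthogonal
  complement of \<open>x\<close>, and \<open>tan_proj x\<close> is the orthogonal projection onto it.\<close>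

definition tan_proj :: "'a::euclidean_space \<Rightarrow> 'a \<Rightarrow> 'a" where
  "tan_proj x v = v - (v \<bullet> x) *\<^sub>R x"

definition smooth_sphere_map :: "('a::euclidean_space \<Rightarrow> 'a) \<Rightarrow> bool" where
  "smooth_sphere_map \<phi> \<longleftrightarrow> \<phi> ` sphere 0 1 \<subseteq> sphere 0 1 \<and>
     smooth_on (- {0}) (\<lambda>y. \<phi> (y /\<^sub>R norm y))"

text \<open>The derivative at \<open>x\<close> in the tangent direction \<open>v\<close> of a vector-valued function on the sphere,
  computed through its radially constant extension.\<close>

definition sphere_deriv :: "('a::euclidean_space \<Rightarrow> 'a) \<Rightarrow> 'a \<Rightarrow> 'a \<Rightarrow> 'a" where
  "sphere_deriv f x v = frechet_derivative (\<lambda>y. f (y /\<^sub>R norm y)) (at x) v"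

text \<open>The covariant derivative of a vector field \<open>W\<close> along \<open>\<phi>\<close>, that is \<open>W y\<close> is tangent to the
  sphere at \<open>\<phi> y\<close>.  For \<open>\<phi> = (\<lambda>y. y)\<close> this is the Levi-Civita connection of the sphere.\<close>

definition cov_deriv_along ::
  "('a::euclidean_space \<Rightarrow> 'a) \<Rightarrow> ('a \<Rightarrow> 'a) \<Rightarrow> 'a \<Rightarrow> 'a \<Rightarrow> 'a" where
  "cov_deriv_along \<phi> W x v = tan_proj (\<phi> x) (sphere_deriv W x v)"

text \<open>The second fundamental form
  \<open>(\<nabla>d\<phi>)(v, w) = \<nabla>\<^sub>v (d\<phi> Y) - d\<phi> (\<nabla>\<^sub>v Y)\<close>, where \<open>Y\<close> is the vector field
  \<open>Y y = tan_proj y w\<close> extending the tangent vector \<open>w\<close> at \<open>x\<close>.\<close>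

definition second_fund_form ::
  "('a::euclidean_space \<Rightarrow> 'a) \<Rightarrow> 'a \<Rightarrow> 'a \<Rightarrow> 'a \<Rightarrow> 'a" where
  "second_fund_form \<phi> x v w =
     cov_deriv_along \<phi> (\<lambda>y. sphere_deriv \<phi> y (tan_proj y w)) x v
     - sphere_deriv \<phi> x (cov_deriv_along (\<lambda>y. y) (\<lambda>y. tan_proj y w) x v)"

definition tangent_onb :: "'a::euclidean_space \<Rightarrow> 'a set \<Rightarrow> bool" where
  "tangent_onb x B \<longleftrightarrow> pairwise orthogonal B \<and> (\<forall>e\<in>B. norm e = 1) \<and> span B = {v. v \<bullet> x = 0}"

text \<open>The trace of \<open>\<nabla>d\<phi>\<close>; it does not depend on the orthonormal basis.\<close>

definition tension_field :: "('a::euclidean_space \<Rightarrow> 'a) \<Rightarrow> 'a \<Rightarrow> 'a" where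
  "tension_field \<phi> x = (\<Sum>e\<in>(SOME B. tangent_onb x B). second_fund_form \<phi> x e e)"

definition harmonic :: "('a::euclidean_space \<Rightarrow> 'a) \<Rightarrow> bool" where
  "harmonic \<phi> \<longleftrightarrow> (\<forall>x\<in>sphere 0 1. tension_field \<phi> x = 0)"

definition unit_speed_geodesic :: "(real \<Rightarrow> 'a::euclidean_space) \<Rightarrow> bool" where
  "unit_speed_geodesic \<gamma> \<longleftrightarrow>
     (\<forall>t. \<gamma> t \<in> sphere 0 1 \<and> \<gamma> differentiable (at t) \<and> norm (vector_derivative \<gamma> (at t)) = 1 \<and>
        (\<exists>acc. ((\<lambda>s. vector_derivative \<gamma> (at s)) has_vector_derivative acc) (at t) \<and>
               tan_proj (\<gamma> t) acc = 0))"


section \<open>Principal curvatures of hypersurfaces of the sphere\<close>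

text \<open>Used for orbits only, which are embedded submanifolds: for these, velocities of curves that are
  differentiable at the base point already form the tangent space.\<close>

definition tangent_space :: "'a::euclidean_space set \<Rightarrow> 'a \<Rightarrow> 'a set" where
  "tangent_space M p =
     {v. \<exists>c. (\<forall>s::real. c s \<in> M) \<and> c 0 = p \<and> (c has_vector_derivative v) (at 0)}"

definition unit_normal_field :: "'a::euclidean_space set \<Rightarrow> ('a \<Rightarrow> 'a) \<Rightarrow> bool" where
  "unit_normal_field M \<nu> \<longleftrightarrow> continuous_on M \<nu> \<and>
     (\<forall>q\<in>M. norm (\<nu> q) = 1 \<and> \<nu> q \<bullet> q = 0 \<and> (\<forall>v\<in>tangent_space M q. \<nu> q \<bullet> v = 0))"

text \<open>The eigenspace for \<open>l\<close> of the shape operator \<open>v \<mapsto> - \<nabla>\<^sub>v \<nu>\<close> at \<open>p\<close>.  The ambient derivative of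
  \<open>\<nu>\<close> in a direction tangent to \<open>M\<close> is orthogonal to \<open>p\<close> (differentiate \<open>\<nu> q \<bullet> q = 0\<close>), so no
  projection to the sphere is needed.\<close>

definition curvature_eigenspace ::
  "'a::euclidean_space set \<Rightarrow> ('a \<Rightarrow> 'a) \<Rightarrow> 'a \<Rightarrow> real \<Rightarrow> 'a set" where
  "curvature_eigenspace M \<nu> p l =
     {v. \<exists>c. (\<forall>s::real. c s \<in> M) \<and> c 0 = p \<and> (c has_vector_derivative v) (at 0) \<and>
             ((\<lambda>s. \<nu> (c s)) has_vector_derivative - (l *\<^sub>R v)) (at 0)}"

definition principal_curvatures :: "'a::euclidean_space set \<Rightarrow> ('a \<Rightarrow> 'a) \<Rightarrow> 'a \<Rightarrow> real set" where
  "principal_curvatures M \<nu> p = {l. \<exists>v\<in>curvature_eigenspace M \<nu> p l. v \<noteq> 0}"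

definition parity_mult :: "nat \<Rightarrow> nat \<Rightarrow> nat \<Rightarrow> nat" where
  "parity_mult m0 m1 i = (if even i then m0 else m1)"

text \<open>\<open>M\<close> has \<open>g\<close> distinct principal curvatures \<open>\<lambda> 0 > \<lambda> 1 > \<dots> > \<lambda> (g - 1)\<close>, of multiplicities
  \<open>m\<^sub>i\<close>.  Replacing \<open>\<nu>\<close> by \<open>-\<nu>\<close> reverses the list.\<close>

definition has_principal_curvature_data :: "'a::euclidean_space set \<Rightarrow> nat \<Rightarrow> nat \<Rightarrow> nat \<Rightarrow> bool" where
  "has_principal_curvature_data M g m0 m1 \<longleftrightarrow>
     (\<exists>\<nu>. unit_normal_field M \<nu> \<and>
        (\<forall>p\<in>M. \<exists>l :: nat \<Rightarrow> real.
           (\<forall>i j. i < j \<and> j < g \<longrightarrow> l j < l i) \<and>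
           principal_curvatures M \<nu> p = l ` {..<g} \<and>
           (\<forall>i<g. dim (curvature_eigenspace M \<nu> p (l i)) = parity_mult m0 m1 i)))"


section \<open>Cohomogeneity one actions on the sphere\<close>

text \<open>Preserving the chordal distance \<open>dist\<close> is the same as preserving the spherical distance.
  A continuous isometric action of a Lie group is smooth.\<close>

definition isometric_sphere_action ::
  "('g, 'r) monoid_scheme \<Rightarrow> 'g topology \<Rightarrow> ('g \<Rightarrow> 'a::euclidean_space \<Rightarrow> 'a) \<Rightarrow> bool" where
  "isometric_sphere_action G T act \<longleftrightarrow>
     group_action G (sphere 0 1) act \<and>
     continuous_map (prod_topology T (top_of_set (sphere 0 1))) (top_of_set (sphere 0 1))
       (\<lambda>(a, x). act a x) \<and>
     (\<forall>a\<in>carrier G. \<forall>x\<in>sphere 0 1. \<forall>y\<in>sphere 0 1. dist (act a x) (act a y) = dist x y)"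

text \<open>\<open>p\<close> lies in a principal orbit if its isotropy group is conjugate to a subgroup of every
  isotropy group; the conjugates of the isotropy group of \<open>p\<close> are those of the points \<open>act a p\<close>.\<close>

definition principal_point ::
  "('g, 'r) monoid_scheme \<Rightarrow> ('g \<Rightarrow> 'a::euclidean_space \<Rightarrow> 'a) \<Rightarrow> 'a \<Rightarrow> bool" where
  "principal_point G act p \<longleftrightarrow> p \<in> sphere 0 1 \<and>
     (\<forall>q\<in>sphere 0 1. \<exists>a\<in>carrier G. stabilizer G act (act a p) \<subseteq> stabilizer G act q)"

text \<open>Cohomogeneity one: principal orbits have codimension one in the sphere, whose dimension is
  \<open>DIM('a) - 1\<close>.\<close>

definition gmm_action ::
  "('g, 'r) monoid_scheme \<Rightarrow> 'g topology \<Rightarrow> ('g set \<times> ('g \<Rightarrow> 'e::euclidean_space)) set \<Rightarrow>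
   ('g \<Rightarrow> 'a::euclidean_space \<Rightarrow> 'a) \<Rightarrow> nat \<Rightarrow> nat \<Rightarrow> nat \<Rightarrow> bool" where
  "gmm_action G T A act g m0 m1 \<longleftrightarrow>
     compact_lie_group G T A \<and> isometric_sphere_action G T act \<and>
     0 < g \<and> (odd g \<longrightarrow> m0 = m1) \<and>
     (\<forall>p. principal_point G act p \<longrightarrow>
        dim (tangent_space (orbit G act p) p) + 2 = DIM('a) \<and>
        has_principal_curvature_data (orbit G act p) g m0 m1)"

definition normal_geodesic ::
  "('g, 'r) monoid_scheme \<Rightarrow> ('g \<Rightarrow> 'a::euclidean_space \<Rightarrow> 'a) \<Rightarrow> (real \<Rightarrow> 'a) \<Rightarrow> bool" where
  "normal_geodesic G act \<gamma> \<longleftrightarrow> unit_speed_geodesic \<gamma> \<and>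
     (\<forall>x\<in>sphere 0 1. \<exists>t. \<gamma> t \<in> orbit G act x) \<and>
     (\<forall>t. \<forall>v\<in>tangent_space (orbit G act (\<gamma> t)) (\<gamma> t). vector_derivative \<gamma> (at t) \<bullet> v = 0) \<and>
     \<not> principal_point G act (\<gamma> 0)"

text \<open>The orbit space is \<open>[0, \<pi>/g]\<close>, parametrized by \<open>\<gamma>\<close>, and the non-principal isotropy groups occur
  exactly at the points \<open>\<gamma> (i \<pi>/g)\<close>.  With \<open>K\<^sub>i\<close> the isotropy group of \<open>\<gamma> (i \<pi>/g)\<close> and \<open>H\<close> that of
  \<open>\<gamma> t\<close>, \<open>0 < t < \<pi>/g\<close>, the homogeneous space \<open>K\<^sub>i/H\<close> is the \<open>K\<^sub>i\<close>-orbit of \<open>\<gamma> t\<close>; its dimension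
  is \<open>m\<^sub>i\<close>, which fixes the numbering of \<open>m\<^sub>0, m\<^sub>1\<close>.\<close>

definition orbit_space_data ::
  "('g, 'r) monoid_scheme \<Rightarrow> ('g \<Rightarrow> 'a::euclidean_space \<Rightarrow> 'a) \<Rightarrow> (real \<Rightarrow> 'a) \<Rightarrow>
   nat \<Rightarrow> nat \<Rightarrow> nat \<Rightarrow> bool" where
  "orbit_space_data G act \<gamma> g m0 m1 \<longleftrightarrow>
     (\<forall>x\<in>sphere 0 1. \<exists>!t. t \<in> {0..pi / real g} \<and> \<gamma> t \<in> orbit G act x) \<and>
     (\<forall>t. \<not> principal_point G act (\<gamma> t) \<longleftrightarrow> (\<exists>i::int. t = of_int i * pi / real g)) \<and>
     (\<forall>i::nat. \<forall>t\<in>{0<..<pi / real g}.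
        dim (tangent_space
          ((\<lambda>a. act a (\<gamma> t)) ` stabilizer G act (\<gamma> (real i * pi / real g))) (\<gamma> t))
        = parity_mult m0 m1 i)"

text \<open>As every orbit meets \<open>\<gamma>\<close>, this determines \<open>\<phi>\<close> on the sphere.\<close>

definition is_k_map ::
  "('g, 'r) monoid_scheme \<Rightarrow> ('g \<Rightarrow> 'a::euclidean_space \<Rightarrow> 'a) \<Rightarrow> (real \<Rightarrow> 'a) \<Rightarrow> int \<Rightarrow>
   ('a \<Rightarrow> 'a) \<Rightarrow> bool" where
  "is_k_map G act \<gamma> k \<phi> \<longleftrightarrow> smooth_sphere_map \<phi> \<and>
     (\<forall>a\<in>carrier G. \<forall>t. \<phi> (act a (\<gamma> t)) = act a (\<gamma> (of_int k * t)))"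

end

theory Submission
  imports Defs
begin

text \<open>
  The tension field of a map into the sphere is the tangential part of the Laplacian of any homogeneous
  extension.  For a \<open>k\<close>-map with \<open>k \<noteq> 1\<close> the extension \<open>\<Psi>\<close> of degree \<open>-k\<close> is a gradient:
  \<open>(1 - k) \<Psi>\<close> is the gradient of \<open>\<Psi> y \<bullet> y\<close>.  Hence the Laplacian of \<open>\<Psi>\<close> is the gradient of its
  divergence, which is invariant under the action, and harmonicity becomes an ordinary differential
  equation for \<open>q t = div \<Psi> (\<gamma> t)\<close>, with no condition left in the directions of the orbits.

  The isotropy groups at the points \<open>\<gamma> (i \<pi>/g)\<close> provide the eigenvectors of the derivative of \<open>\<Psi>\<close>
  along \<open>\<gamma>\<close>, with eigenvalues \<open>sin (k t - i \<pi>/g) / sin (t - i \<pi>/g)\<close>.  With \<open>d = 1 - k\<close>, summing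
  cotangents gives
  \<open>q t = (g/2) ((m\<^sub>0 + m\<^sub>1) cos (d t) - sin (d t) (m\<^sub>0 cot (g t/2) - m\<^sub>1 tan (g t/2)))\<close>, and the equation
  reads \<open>(2 - d) q t sin (d t) = q' t cos (d t)\<close>.  If \<open>d \<noteq> 2\<close>, then \<open>q\<close> vanishes at all zeros of
  \<open>cos (d t)\<close> in \<open>(0, \<pi>/g)\<close>, where \<open>m\<^sub>0 cot (g t/2) - m\<^sub>1 tan (g t/2)\<close> has only one zero.
\<close>

section \<open>Second derivatives and traces\<close>

text \<open>The mean value theorem in the direction \<open>w\<close> turns the second difference
  into an increment of \<open>\<lambda>y. f' y w\<close>, which differentiability of that function
  at \<open>x\<close> controls.\<close>

lemma second_difference_tendsto:
  fixes f :: "'a::real_normed_vector \<Rightarrow> real"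
  assumes S: "open S" "x \<in> S"
    and f': "\<And>y. y \<in> S \<Longrightarrow> (f has_derivative f' y) (at y)"
    and L: "((\<lambda>y. f' y w) has_derivative L) (at x)"
  shows "((\<lambda>t. (f (x + t *\<^sub>R v + t *\<^sub>R w) - f (x + t *\<^sub>R v) - f (x + t *\<^sub>R w) + f x) / t\<^sup>2)
    \<longlongrightarrow> L v) (at_right 0)"
proof (rule tendstoI)
  fix e :: real assume "e > 0"
  \<comment> \<open>The two points compared below lie within \<open>t * (norm v + norm w)\<close>
    and \<open>t * norm w\<close> of \<open>x\<close>; \<open>t * C\<close> dominates the sum of
    these bounds, and the \<open>1\<close> keeps \<open>C\<close> positive.\<close>
  define C where "C = norm v + 2 * norm w + 1"
  have "C > 0" unfolding C_def by (smt (verit) norm_ge_zero)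
  define e' where "e' = e / (2 * C)"
  have e': "e' > 0" using \<open>e > 0\<close> \<open>C > 0\<close> by (simp add: e'_def)
  have lin: "bounded_linear L" using L by (rule has_derivative_bounded_linear)
  obtain d1 where d1: "d1 > 0"
    "\<And>y. norm (y - x) < d1 \<Longrightarrow> norm (f' y w - f' x w - L (y - x)) \<le> e' * norm (y - x)"
    using L e' unfolding has_derivative_at_alt by blast
  obtain d2 where d2: "d2 > 0" "ball x d2 \<subseteq> S"
    using S open_contains_ball by blast
  define d where "d = min d1 d2 / C"
  have "d > 0" using d1 d2 \<open>C > 0\<close> by (simp add: d_def)
  have main: "dist ((f (x + t *\<^sub>R v + t *\<^sub>R w) - f (x + t *\<^sub>R v) - f (x + t *\<^sub>R w) + f x) / t\<^sup>2) (L v) < e"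
    if t: "0 < t" "t < d" for t
  proof -
    have tC: "t * C < min d1 d2" using t \<open>C > 0\<close> by (simp add: d_def field_simps)
    have small: "norm (a *\<^sub>R v + s *\<^sub>R w) \<le> t * (norm v + norm w)"
      if "0 \<le> a" "a \<le> t" "0 \<le> s" "s \<le> t" for a s
    proof -
      have "norm (a *\<^sub>R v + s *\<^sub>R w) \<le> a * norm v + s * norm w"
        using that by (metis norm_scaleR norm_triangle_ineq abs_of_nonneg)
      also have "\<dots> \<le> t * norm v + t * norm w"
        using that by (intro add_mono mult_right_mono) auto
      finally show ?thesis by (simp add: algebra_simps)
    qed
    have "t * (norm v + norm w) \<le> t * C" using t unfolding C_def
      by (intro mult_left_mono) auto
    then have near: "norm (a *\<^sub>R v + s *\<^sub>R w) < min d1 d2"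
      if "0 \<le> a" "a \<le> t" "0 \<le> s" "s \<le> t" for a s
      using small[OF that] tC by linarith
    have inS: "x + (a *\<^sub>R v + s *\<^sub>R w) \<in> S" if "0 \<le> a" "a \<le> t" "0 \<le> s" "s \<le> t" for a s
    proof -
      have "x + (a *\<^sub>R v + s *\<^sub>R w) \<in> ball x d2"
        using near[OF that] by (simp add: dist_norm del: minus_add_distrib)
      then show ?thesis using d2 by blast
    qed
    \<comment> \<open>The summand \<open>0 *\<^sub>R v\<close> gives both terms the shape that
      \<open>fd\<close> differentiates.\<close>
    define h where "h s = f (x + (t *\<^sub>R v + s *\<^sub>R w)) - f (x + (0 *\<^sub>R v + s *\<^sub>R w))" for s
    have fd: "((\<lambda>s. f (x + (a *\<^sub>R v + s *\<^sub>R w))) has_real_derivative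
        f' (x + (a *\<^sub>R v + s *\<^sub>R w)) w) (at s)"
      if "0 \<le> a" "a \<le> t" "0 \<le> s" "s \<le> t" for a s
    proof -
      have "((\<lambda>s. x + (a *\<^sub>R v + s *\<^sub>R w)) has_derivative (\<lambda>r. r *\<^sub>R w)) (at s)"
        by (auto intro!: derivative_eq_intros)
      from has_derivative_compose[OF this f'[OF inS[OF that]]]
      have "((\<lambda>s. f (x + (a *\<^sub>R v + s *\<^sub>R w))) has_derivative
          (\<lambda>r. f' (x + (a *\<^sub>R v + s *\<^sub>R w)) (r *\<^sub>R w))) (at s)" .
      moreover have "(\<lambda>r. f' (x + (a *\<^sub>R v + s *\<^sub>R w)) (r *\<^sub>R w)) =
          (*) (f' (x + (a *\<^sub>R v + s *\<^sub>R w)) w)"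
        using linear_scale[OF has_derivative_linear[OF f'[OF inS[OF that]]]] by (simp add: fun_eq_iff)
      ultimately show ?thesis by (simp add: has_field_derivative_def)
    qed
    have "\<exists>z. 0 < z \<and> z < t \<and> h t - h 0 =
        (t - 0) * (f' (x + (t *\<^sub>R v + z *\<^sub>R w)) w - f' (x + (0 *\<^sub>R v + z *\<^sub>R w)) w)"
      unfolding h_def using t by (intro MVT2 DERIV_diff fd) auto
    then obtain z where z: "0 < z" "z < t" and hz: "h t - h 0 =
        t * (f' (x + (t *\<^sub>R v + z *\<^sub>R w)) w - f' (x + (0 *\<^sub>R v + z *\<^sub>R w)) w)" by auto
    define A where "A = f' (x + (t *\<^sub>R v + z *\<^sub>R w)) w - f' x w - L (t *\<^sub>R v + z *\<^sub>R w)"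
    define B where "B = f' (x + (0 *\<^sub>R v + z *\<^sub>R w)) w - f' x w - L (0 *\<^sub>R v + z *\<^sub>R w)"
    have "\<bar>A\<bar> \<le> e' * norm (t *\<^sub>R v + z *\<^sub>R w)" and "\<bar>B\<bar> \<le> e' * norm (0 *\<^sub>R v + z *\<^sub>R w)"
      using d1(2)[of "x + (t *\<^sub>R v + z *\<^sub>R w)"] d1(2)[of "x + (0 *\<^sub>R v + z *\<^sub>R w)"]
        near[of t z] near[of 0 z] z t unfolding A_def B_def by auto
    moreover have "norm (t *\<^sub>R v + z *\<^sub>R w) \<le> t * norm v + t * norm w"
      using small[of t z] z t by (simp add: algebra_simps)
    moreover have "norm (0 *\<^sub>R v + z *\<^sub>R w) \<le> t * norm w" using z by (simp add: mult_right_mono)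
    ultimately have "\<bar>A - B\<bar> \<le> e' * (t * norm v + t * norm w) + e' * (t * norm w)"
      using e' by (smt (verit) mult_left_mono)
    also have "\<dots> \<le> e' * (t * C)" using e' t by (simp add: C_def algebra_simps)
    also have "\<dots> < e * t" using \<open>C > 0\<close> \<open>e > 0\<close> t by (simp add: e'_def field_simps)
    finally have AB: "\<bar>A - B\<bar> < e * t" .
    have "(h t - h 0) / t = f' (x + (t *\<^sub>R v + z *\<^sub>R w)) w - f' (x + (0 *\<^sub>R v + z *\<^sub>R w)) w"
      using hz t by simp
    then have "A - B = (h t - h 0) / t - t * L v"
      using linear_add[OF bounded_linear.linear[OF lin]] linear_scale[OF bounded_linear.linear[OF lin]]
      unfolding A_def B_def by (simp add: algebra_simps)
    moreover have "X / t\<^sup>2 - l = (A - B) / t" if "A - B = X / t - t * l" for X l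
      using that t by (simp add: diff_divide_distrib power2_eq_square)
    moreover have "h t - h 0 = f (x + t *\<^sub>R v + t *\<^sub>R w) - f (x + t *\<^sub>R v) - f (x + t *\<^sub>R w) + f x"
      by (simp add: h_def algebra_simps)
    ultimately have "(f (x + t *\<^sub>R v + t *\<^sub>R w) - f (x + t *\<^sub>R v) - f (x + t *\<^sub>R w) + f x) / t\<^sup>2 - L v
        = (A - B) / t" by metis
    then show ?thesis using AB t by (simp add: dist_real_def pos_divide_less_eq)
  qed
  show "\<forall>\<^sub>F t in at_right 0. dist ((f (x + t *\<^sub>R v + t *\<^sub>R w) - f (x + t *\<^sub>R v) - f (x + t *\<^sub>R w) + f x) / t\<^sup>2)
      (L v) < e"
    unfolding eventually_at_right_field using main \<open>d > 0\<close> by blast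
qed

text \<open>The second difference is symmetric in \<open>v\<close> and \<open>w\<close>, so both
  values are limits of the same quotient.\<close>

lemma symmetric_second_derivative_real:
  fixes f :: "'a::real_normed_vector \<Rightarrow> real"
  assumes "open S" "x \<in> S"
    and "\<And>y. y \<in> S \<Longrightarrow> (f has_derivative f' y) (at y)"
    and "((\<lambda>y. f' y v) has_derivative Lv) (at x)" "((\<lambda>y. f' y w) has_derivative Lw) (at x)"
  shows "Lv w = Lw v"
proof -
  have "((\<lambda>t. (f (x + t *\<^sub>R v + t *\<^sub>R w) - f (x + t *\<^sub>R v) - f (x + t *\<^sub>R w) + f x) / t\<^sup>2)
    \<longlongrightarrow> Lw v) (at_right 0)"
    by (rule second_difference_tendsto[OF assms(1-3,5)])
  moreover have "((\<lambda>t. (f (x + t *\<^sub>R w + t *\<^sub>R v) - f (x + t *\<^sub>R w) - f (x + t *\<^sub>R v) + f x) / t\<^sup>2)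
    \<longlongrightarrow> Lv w) (at_right 0)"
    by (rule second_difference_tendsto[OF assms(1-4)])
  ultimately show ?thesis
    by (intro tendsto_unique[of "at_right (0::real)"]) (simp_all add: algebra_simps)
qed

section \<open>Twice differentiable maps between Euclidean spaces\<close>

text \<open>Derivatives are taken in fixed directions \<open>w\<close>, as in \<open>Ck_on\<close>,
  which keeps all codomains Euclidean.\<close>

definition twice_differentiable_on ::
  "'a::euclidean_space set \<Rightarrow> ('a \<Rightarrow> 'b::euclidean_space) \<Rightarrow> bool" where
  "twice_differentiable_on S f \<longleftrightarrow> open S \<and> (\<forall>x\<in>S. f differentiable (at x) \<and>
     (\<forall>w. (\<lambda>y. frechet_derivative f (at y) w) differentiable (at x)))"

definition second_derivative ::
  "('a::euclidean_space \<Rightarrow> 'b::euclidean_space) \<Rightarrow> 'a \<Rightarrow> 'a \<Rightarrow> 'a \<Rightarrow> 'b" where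
  "second_derivative f x v w = frechet_derivative (\<lambda>y. frechet_derivative f (at y) w) (at x) v"

lemma smooth_imp_twice_differentiable_on:
  assumes "smooth_on S f"
  shows "twice_differentiable_on S f"
proof -
  have "Ck_on (Suc (Suc 0)) f S" "open S" using assms by (auto simp: smooth_on_def)
  then show ?thesis by (auto simp: twice_differentiable_on_def)
qed

lemma twice_differentiable_onD:
  assumes "twice_differentiable_on S f" "x \<in> S"
  shows "open S" "(f has_derivative frechet_derivative f (at x)) (at x)"
    "((\<lambda>y. frechet_derivative f (at y) w) has_derivative (\<lambda>v. second_derivative f x v w)) (at x)"
  using assms frechet_derivative_works
  unfolding twice_differentiable_on_def second_derivative_def by blast+

lemma linear_frechet_derivative_at:
  "twice_differentiable_on S f \<Longrightarrow> x \<in> S \<Longrightarrow> linear (frechet_derivative f (at x))"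
  by (meson has_derivative_linear twice_differentiable_onD)

text \<open>Linearity in the outer direction is that of a derivative; in the inner direction it is
  inherited from the linearity of the first derivative at all nearby points.\<close>

lemma bilinear_second_derivative:
  assumes f: "twice_differentiable_on S f" and x: "x \<in> S"
  shows "bilinear (second_derivative f x)"
  unfolding bilinear_def
proof (intro conjI allI)
  show "linear (\<lambda>v. second_derivative f x v w)" for w
    using twice_differentiable_onD(3)[OF f x] by (rule has_derivative_linear)
  have S: "open S" using twice_differentiable_onD[OF f x] by blast
  have lin: "linear (frechet_derivative f (at y))" if "y \<in> S" for y
    by (rule linear_frechet_derivative_at[OF f that])
  show "linear (second_derivative f x v)" for v
  proof (rule linearI)
    fix w1 w2
    have "((\<lambda>y. frechet_derivative f (at y) (w1 + w2)) has_derivative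
        (\<lambda>v. second_derivative f x v w1 + second_derivative f x v w2)) (at x)"
      by (rule has_derivative_transform_within_open[OF has_derivative_add[OF
            twice_differentiable_onD(3)[OF f x] twice_differentiable_onD(3)[OF f x]] S x])
        (simp add: linear_add[OF lin])
    from fun_cong[OF has_derivative_unique[OF this twice_differentiable_onD(3)[OF f x]]]
    show "second_derivative f x v (w1 + w2) = second_derivative f x v w1 + second_derivative f x v w2"
      by simp
  next
    fix c w
    have "((\<lambda>y. frechet_derivative f (at y) (c *\<^sub>R w)) has_derivative
        (\<lambda>v. c *\<^sub>R second_derivative f x v w)) (at x)"
      by (rule has_derivative_transform_within_open[OF has_derivative_scaleR_right[OF
            twice_differentiable_onD(3)[OF f x]] S x])
        (simp add: linear_scale[OF lin])
    from fun_cong[OF has_derivative_unique[OF this twice_differentiable_onD(3)[OF f x]]]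
    show "second_derivative f x v (c *\<^sub>R w) = c *\<^sub>R second_derivative f x v w"
      by simp
  qed
qed

lemma symmetric_second_derivative:
  assumes f: "twice_differentiable_on S f" and x: "x \<in> S"
  shows "second_derivative f x v w = second_derivative f x w v"
proof (rule euclidean_eqI)
  fix b :: 'b assume "b \<in> Basis"
  have "((\<lambda>y. f y \<bullet> b) has_derivative (\<lambda>w. frechet_derivative f (at y) w \<bullet> b)) (at y)"
    if "y \<in> S" for y
    by (intro has_derivative_inner_left twice_differentiable_onD(2)[OF f that])
  from symmetric_second_derivative_real[OF twice_differentiable_onD(1)[OF f x] x this
      has_derivative_inner_left[OF twice_differentiable_onD(3)[OF f x]]
      has_derivative_inner_left[OF twice_differentiable_onD(3)[OF f x]]]
  show "second_derivative f x v w \<bullet> b = second_derivative f x w v \<bullet> b" by simp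
qed

section \<open>Traces in orthonormal bases\<close>

definition trace_of :: "('a::euclidean_space \<Rightarrow> 'a) \<Rightarrow> real" where
  "trace_of L = (\<Sum>b\<in>Basis. L b \<bullet> b)"

lemma orthonormal_expansion:
  fixes x :: "'a::euclidean_space"
  assumes "pairwise orthogonal B" "\<And>e. e \<in> B \<Longrightarrow> norm e = 1" "span B = UNIV"
  shows "finite B" "(\<Sum>e\<in>B. (x \<bullet> e) *\<^sub>R e) = x"
proof -
  show fin: "finite B" using assms(1) by (rule pairwise_orthogonal_imp_finite)
  have "x \<in> span B" using assms(3) by simp
  then obtain u where u: "x = (\<Sum>e\<in>B. u e *\<^sub>R e)"
    by (auto simp: span_finite[OF fin])
  have "x \<bullet> e = u e" if e: "e \<in> B" for e
  proof -
    have "x \<bullet> e = (\<Sum>e'\<in>B. u e' * (e' \<bullet> e))" unfolding u by (simp add: inner_sum_left)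
    also have "\<dots> = (\<Sum>e'\<in>B. if e' = e then u e else 0)"
      using assms(1,2) e by (intro sum.cong) (auto simp: pairwise_def orthogonal_def norm_eq_1)
    also have "\<dots> = u e" using fin e by simp
    finally show ?thesis .
  qed
  then show "(\<Sum>e\<in>B. (x \<bullet> e) *\<^sub>R e) = x" using u by simp
qed

text \<open>Expand each \<open>b\<close> in \<open>B\<close>, exchange the sums and recollect
  \<open>e\<close> in \<open>Basis\<close>. This allows bases adapted to the sphere or to the
  orbits.\<close>

lemma sum_orthonormal_basis:
  fixes q :: "'a::euclidean_space \<Rightarrow> 'a \<Rightarrow> real"
  assumes B: "pairwise orthogonal B" "\<And>e. e \<in> B \<Longrightarrow> norm e = 1" "span B = UNIV" and q: "bilinear q"
  shows "(\<Sum>e\<in>B. q e e) = (\<Sum>b\<in>Basis. q b b)"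
proof -
  have l: "linear (\<lambda>v. q v w)" "linear (q w)" for w using q by (auto simp: bilinear_def)
  have "(\<Sum>b\<in>Basis. q b b) = (\<Sum>b\<in>Basis. \<Sum>e\<in>B. (b \<bullet> e) * q e b)"
  proof (rule sum.cong[OF refl])
    fix b :: 'a
    have "q b b = q (\<Sum>e\<in>B. (b \<bullet> e) *\<^sub>R e) b" using orthonormal_expansion(2)[OF B] by simp
    also have "\<dots> = (\<Sum>e\<in>B. (b \<bullet> e) * q e b)"
      by (simp add: linear_sum[OF l(1)] linear_scale[OF l(1)])
    finally show "q b b = (\<Sum>e\<in>B. (b \<bullet> e) * q e b)" .
  qed
  also have "\<dots> = (\<Sum>e\<in>B. \<Sum>b\<in>Basis. (b \<bullet> e) * q e b)" by (rule sum.swap)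
  also have "\<dots> = (\<Sum>e\<in>B. q e e)"
  proof (rule sum.cong[OF refl])
    fix e :: 'a
    have "q e e = q e (\<Sum>b\<in>Basis. (e \<bullet> b) *\<^sub>R b)" by (simp add: euclidean_representation)
    also have "\<dots> = (\<Sum>b\<in>Basis. (b \<bullet> e) * q e b)"
      by (simp add: linear_sum[OF l(2)] linear_scale[OF l(2)] inner_commute)
    finally show "(\<Sum>b\<in>Basis. (b \<bullet> e) * q e b) = q e e" by simp
  qed
  finally show ?thesis by simp
qed

lemma trace_of_orthonormal:
  assumes "pairwise orthogonal B" "\<And>e. e \<in> B \<Longrightarrow> norm e = 1" "span B = UNIV" "linear L"
  shows "trace_of L = (\<Sum>e\<in>B. L e \<bullet> e)"
proof -
  have "bilinear (\<lambda>v w. L v \<bullet> w)"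
    unfolding bilinear_def using assms(4)
    by (auto intro!: linearI simp: linear_add linear_scale inner_add_left inner_add_right)
  from sum_orthonormal_basis[OF assms(1-3) this] show ?thesis by (simp add: trace_of_def)
qed

section \<open>The tension field through homogeneous extensions\<close>

text \<open>Any formula \<open>f'\<close> for the derivative may be used: on an open set it agrees
  with \<open>frechet_derivative\<close> near each point.\<close>

lemma twice_differentiable_onI:
  assumes "open S" and f: "\<And>x. x \<in> S \<Longrightarrow> (f has_derivative f' x) (at x)"
    and f': "\<And>x w. x \<in> S \<Longrightarrow> (\<lambda>y. f' y w) differentiable (at x)"
  shows "twice_differentiable_on S f"
  unfolding twice_differentiable_on_def
proof (intro conjI ballI allI)
  fix x w assume x: "x \<in> S"
  show "f differentiable (at x)" using f[OF x] differentiableI by blast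
  obtain D where "((\<lambda>y. f' y w) has_derivative D) (at x)"
    using f'[OF x] unfolding differentiable_def by blast
  from has_derivative_transform_within_open[OF this \<open>open S\<close> x, of "\<lambda>y. frechet_derivative f (at y) w"]
  have "((\<lambda>y. frechet_derivative f (at y) w) has_derivative D) (at x)"
    using f frechet_derivative_at by metis
  then show "(\<lambda>y. frechet_derivative f (at y) w) differentiable (at x)"
    using differentiableI by blast
qed (rule \<open>open S\<close>)

lemma twice_differentiable_on_scaleR:
  assumes c: "twice_differentiable_on S c" and f: "twice_differentiable_on S f"
  shows "twice_differentiable_on S (\<lambda>y. (c y :: real) *\<^sub>R f y)"
proof (rule twice_differentiable_onI)
  show "open S" using c by (simp add: twice_differentiable_on_def)
  fix x assume x: "x \<in> S"
  show "((\<lambda>y. c y *\<^sub>R f y) has_derivative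
      (\<lambda>w. c x *\<^sub>R frechet_derivative f (at x) w + frechet_derivative c (at x) w *\<^sub>R f x)) (at x)"
    by (rule has_derivative_scaleR[OF twice_differentiable_onD(2)[OF c x] twice_differentiable_onD(2)[OF f x]])
  show "(\<lambda>y. c y *\<^sub>R frechet_derivative f (at y) w + frechet_derivative c (at y) w *\<^sub>R f y)
      differentiable (at x)" for w
    using c f x unfolding twice_differentiable_on_def
    by (auto intro!: differentiable_add differentiable_scaleR)
qed

section \<open>Homogeneous extensions and Euler's relation\<close>

text \<open>The gradient is written with the power \<open>r - 2\<close> of the norm and the vector
  \<open>x\<close> itself, so that the same lemma applies to it again.\<close>

lemma has_derivative_norm_powi:
  fixes x :: "'a::real_inner"
  assumes "x \<noteq> 0"
  shows "((\<lambda>y. norm y powi r) has_derivative (\<lambda>w. of_int r * norm x powi (r - 2) * (x \<bullet> w))) (at x)"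
proof -
  have "((\<lambda>y. norm y powi r) has_derivative
      (\<lambda>w. (w \<bullet> sgn x) * (of_int r * norm x powi (r - 1)))) (at x)"
    using assms has_derivative_power_int[OF _ has_derivative_norm] by fastforce
  moreover have "norm x powi (r - 1) = norm x powi (r - 2) * norm x"
    using assms power_int_add[of "norm x" "r - 2" 1] by simp
  then have "(w \<bullet> sgn x) * (of_int r * norm x powi (r - 1)) = of_int r * norm x powi (r - 2) * (x \<bullet> w)" for w
    using assms by (simp add: sgn_div_norm inner_commute)
  ultimately show ?thesis by simp
qed

lemma twice_differentiable_on_norm_powi:
  "twice_differentiable_on (- {0 :: 'a::euclidean_space}) (\<lambda>y. norm y powi r)"
proof (rule twice_differentiable_onI)
  fix x w :: 'a assume x: "x \<in> - {0}"
  then show "((\<lambda>y. norm y powi r) has_derivative (\<lambda>w. of_int r * norm x powi (r - 2) * (x \<bullet> w))) (at x)"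
    by (intro has_derivative_norm_powi) auto
  show "(\<lambda>y. of_int r * norm y powi (r - 2) * (y \<bullet> w)) differentiable (at x)"
    using has_derivative_norm_powi[of x "r - 2"] x
    by (intro differentiable_mult differentiable_const differentiable_inner differentiable_ident)
       (auto simp: differentiable_def)
qed auto

lemma smooth_sphere_map_norm:
  "smooth_sphere_map \<phi> \<Longrightarrow> norm x = 1 \<Longrightarrow> norm (\<phi> x) = 1"
  by (auto simp: smooth_sphere_map_def image_subset_iff)

text \<open>Degree \<open>0\<close> is the radially constant extension behind
  \<open>sphere_deriv\<close>. The degree is kept free because \<open>r = - k\<close> makes the
  extension of a \<open>k\<close>-map with \<open>k \<noteq> 1\<close> a gradient field, and
  \<open>r = 1\<close> suits the identity.\<close>

definition homogeneous_ext :: "int \<Rightarrow> ('a::euclidean_space \<Rightarrow> 'a) \<Rightarrow> 'a \<Rightarrow> 'a" where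
  "homogeneous_ext r \<phi> y = norm y powi r *\<^sub>R \<phi> (y /\<^sub>R norm y)"

lemma homogeneous_ext_unit: "norm x = 1 \<Longrightarrow> homogeneous_ext r \<phi> x = \<phi> x"
  by (simp add: homogeneous_ext_def)

lemma homogeneous_ext_scale:
  "c > 0 \<Longrightarrow> homogeneous_ext r \<phi> (c *\<^sub>R y) = c powi r *\<^sub>R homogeneous_ext r \<phi> y"
  by (cases "y = 0") (simp_all add: homogeneous_ext_def power_int_mult_distrib field_simps)

lemma sphere_deriv_eq: "sphere_deriv \<phi> x = frechet_derivative (homogeneous_ext 0 \<phi>) (at x)"
  by (simp add: fun_eq_iff sphere_deriv_def homogeneous_ext_def[abs_def])

lemma twice_differentiable_on_homogeneous_ext:
  assumes "smooth_sphere_map \<phi>"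
  shows "twice_differentiable_on (- {0}) (homogeneous_ext r \<phi>)"
proof -
  have "twice_differentiable_on (- {0}) (\<lambda>y. \<phi> (y /\<^sub>R norm y))"
    using assms smooth_imp_twice_differentiable_on by (auto simp: smooth_sphere_map_def)
  from twice_differentiable_on_scaleR[OF twice_differentiable_on_norm_powi this]
  show ?thesis by (simp add: homogeneous_ext_def[abs_def])
qed

text \<open>Changing the degree multiplies by a power of the norm, which is constant along the
  sphere; only the radial derivative is affected.\<close>

lemma homogeneous_ext_deriv_unit:
  assumes \<phi>: "smooth_sphere_map \<phi>" and x: "norm x = 1"
  shows "frechet_derivative (homogeneous_ext r \<phi>) (at x) w =
    frechet_derivative (homogeneous_ext 0 \<phi>) (at x) w + (of_int r * (x \<bullet> w)) *\<^sub>R \<phi> x"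
proof -
  have x0: "x \<in> - {0}" using x by auto
  have eq: "homogeneous_ext r \<phi> = (\<lambda>y. norm y powi r *\<^sub>R homogeneous_ext 0 \<phi> y)"
    by (simp add: homogeneous_ext_def[abs_def])
  have "(homogeneous_ext r \<phi> has_derivative (\<lambda>w. norm x powi r *\<^sub>R frechet_derivative (homogeneous_ext 0 \<phi>) (at x) w
      + (of_int r * norm x powi (r - 2) * (x \<bullet> w)) *\<^sub>R homogeneous_ext 0 \<phi> x)) (at x)"
    unfolding eq using x0
    by (intro has_derivative_scaleR has_derivative_norm_powi
        twice_differentiable_onD(2)[OF twice_differentiable_on_homogeneous_ext[OF \<phi>]]) auto
  from frechet_derivative_at[OF this, symmetric] show ?thesis
    using x by (simp add: homogeneous_ext_unit)
qed

text \<open>The chain rule on both sides of \<open>f (M z) = N (f z)\<close>. It serves for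
  dilations and for orthogonal maps.\<close>

lemma frechet_derivative_equivariant:
  assumes f: "twice_differentiable_on S f" and y: "y \<in> S" "M y \<in> S" and MN: "linear M" "linear N"
    and eq: "\<And>z. z \<in> S \<Longrightarrow> f (M z) = N (f z)"
  shows "frechet_derivative f (at (M y)) (M w) = N (frechet_derivative f (at y) w)"
proof -
  have "((\<lambda>z. f (M z)) has_derivative (\<lambda>w. frechet_derivative f (at (M y)) (M w))) (at y)"
    using has_derivative_compose[OF linear_imp_has_derivative[OF MN(1)] twice_differentiable_onD(2)[OF f y(2)]] .
  moreover have "((\<lambda>z. N (f z)) has_derivative (\<lambda>w. N (frechet_derivative f (at y) w))) (at y)"
    using has_derivative_compose[OF twice_differentiable_onD(2)[OF f y(1)] linear_imp_has_derivative[OF MN(2)]] .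
  then have "((\<lambda>z. f (M z)) has_derivative (\<lambda>w. N (frechet_derivative f (at y) w))) (at y)"
    by (rule has_derivative_transform_within_open[OF _ twice_differentiable_onD(1)[OF f y(1)] y(1)])
      (simp add: eq)
  ultimately show ?thesis using fun_cong[OF has_derivative_unique] by blast
qed

lemma frechet_derivative_homogeneous_ext_scale:
  assumes \<phi>: "smooth_sphere_map \<phi>" and y: "y \<noteq> 0" and c: "c > 0"
  shows "frechet_derivative (homogeneous_ext r \<phi>) (at (c *\<^sub>R y)) w =
    c powi (r - 1) *\<^sub>R frechet_derivative (homogeneous_ext r \<phi>) (at y) w"
proof -
  let ?F = "homogeneous_ext r \<phi>"
  note t = twice_differentiable_on_homogeneous_ext[OF \<phi>]
  have "frechet_derivative ?F (at (c *\<^sub>R y)) (c *\<^sub>R w) = c powi r *\<^sub>R frechet_derivative ?F (at y) w"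
    using c y homogeneous_ext_scale[OF c]
    by (intro frechet_derivative_equivariant[OF t]) (auto intro!: linearI simp: algebra_simps)
  moreover have "frechet_derivative ?F (at (c *\<^sub>R y)) (c *\<^sub>R w) = c *\<^sub>R frechet_derivative ?F (at (c *\<^sub>R y)) w"
    using c y by (intro linear_scale linear_frechet_derivative_at[OF t]) auto
  moreover have "c powi r = c * c powi (r - 1)"
    using c power_int_add[of c 1 "r - 1"] by simp
  ultimately show ?thesis
    using c by (metis less_irrefl scaleR_left_imp_eq scaleR_scaleR)
qed

text \<open>Differentiate \<open>f (c *\<^sub>R x)\<close> with respect to \<open>c\<close> at
  \<open>c = 1\<close>.\<close>

lemma euler_homogeneous:
  fixes f :: "'a::euclidean_space \<Rightarrow> 'b::euclidean_space"
  assumes f: "(f has_derivative f') (at x)" and h: "\<And>c. c > 0 \<Longrightarrow> f (c *\<^sub>R x) = c powi r *\<^sub>R f x"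
  shows "f' x = of_int r *\<^sub>R f x"
proof -
  have "((\<lambda>c. c *\<^sub>R x) has_derivative (\<lambda>s. s *\<^sub>R x)) (at (1::real))"
    by (auto intro!: derivative_eq_intros)
  then have "((\<lambda>c. f (c *\<^sub>R x)) has_derivative (\<lambda>s. f' (s *\<^sub>R x))) (at (1::real))"
    using has_derivative_compose[of "\<lambda>c. c *\<^sub>R x" _ 1 UNIV f f'] f by simp
  moreover have "((\<lambda>c. c powi r *\<^sub>R f x) has_derivative (\<lambda>s. (s * of_int r) *\<^sub>R f x)) (at (1::real))"
    by (auto intro!: derivative_eq_intros)
  then have "((\<lambda>c. f (c *\<^sub>R x)) has_derivative (\<lambda>s. (s * of_int r) *\<^sub>R f x)) (at (1::real))"
    by (rule has_derivative_transform_within_open[where s = "{0<..}"]) (auto simp: h)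
  ultimately have "(\<lambda>s. f' (s *\<^sub>R x)) = (\<lambda>s. (s * of_int r) *\<^sub>R f x)"
    using has_derivative_unique by blast
  from fun_cong[OF this, of 1] show ?thesis by simp
qed

text \<open>The second relation is the first principle applied to the derivative in the direction
  \<open>w\<close>, which is homogeneous of degree \<open>r - 1\<close>.\<close>

lemma homogeneous_ext_euler:
  assumes \<phi>: "smooth_sphere_map \<phi>" and x: "x \<noteq> 0"
  shows "frechet_derivative (homogeneous_ext r \<phi>) (at x) x = of_int r *\<^sub>R homogeneous_ext r \<phi> x"
    and "second_derivative (homogeneous_ext r \<phi>) x x w =
      of_int (r - 1) *\<^sub>R frechet_derivative (homogeneous_ext r \<phi>) (at x) w"
proof -
  let ?F = "homogeneous_ext r \<phi>"
  note t = twice_differentiable_on_homogeneous_ext[OF \<phi>]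
  have x0: "x \<in> - {0}" using x by simp
  show "frechet_derivative ?F (at x) x = of_int r *\<^sub>R ?F x"
    by (rule euler_homogeneous[OF twice_differentiable_onD(2)[OF t x0] homogeneous_ext_scale])
  show "second_derivative ?F x x w = of_int (r - 1) *\<^sub>R frechet_derivative ?F (at x) w"
  proof (rule euler_homogeneous[OF twice_differentiable_onD(3)[OF t x0]])
    fix c :: real assume c: "c > 0"
    then show "frechet_derivative ?F (at (c *\<^sub>R x)) w = c powi (r - 1) *\<^sub>R frechet_derivative ?F (at x) w"
      by (rule frechet_derivative_homogeneous_ext_scale[OF \<phi> x])
  qed
qed

section \<open>The tension field as a projected Laplacian\<close>

lemma has_derivative_normalize:
  fixes x :: "'a::euclidean_space"
  assumes "norm x = 1"
  shows "((\<lambda>y. y /\<^sub>R norm y) has_derivative tan_proj x) (at x)"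
proof -
  have "x \<noteq> 0" using assms by auto
  have "((\<lambda>y. norm y powi (-1) *\<^sub>R y) has_derivative
     (\<lambda>w. norm x powi (-1) *\<^sub>R w + (of_int (-1) * norm x powi (-1 - 2) * (x \<bullet> w)) *\<^sub>R x)) (at x)"
    by (intro has_derivative_scaleR has_derivative_norm_powi has_derivative_ident \<open>x \<noteq> 0\<close>)
  then show ?thesis using assms by (simp add: tan_proj_def[abs_def] inner_commute power_int_minus)
qed

lemma tan_proj_diff_normal: "norm p = 1 \<Longrightarrow> tan_proj p (u - c *\<^sub>R p) = tan_proj p u"
  by (simp add: tan_proj_def algebra_simps norm_eq_1)

text \<open>On the sphere the two first derivatives differ by a multiple of \<open>\<phi>\<close>
  whose coefficient vanishes at \<open>x\<close>. Differentiating once more leaves only a multiple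
  of \<open>\<phi> x\<close>, which \<open>tan_proj\<close> removes, whatever the degree
  \<open>r\<close>.\<close>

lemma second_fund_form_eq:
  assumes \<phi>: "smooth_sphere_map \<phi>" and x: "norm x = 1" and e: "e \<bullet> x = 0"
  shows "second_fund_form \<phi> x e e = tan_proj (\<phi> x) (second_derivative (homogeneous_ext r \<phi>) x e e)"
proof -
  let ?F = "homogeneous_ext r \<phi>"
  note t = twice_differentiable_on_homogeneous_ext[OF \<phi>]
  have x0: "x \<in> - {0}" and x1: "x \<noteq> 0" using x by auto
  have te: "tan_proj x e = e" using e by (simp add: tan_proj_def)
  have u: "norm (y /\<^sub>R norm y) = 1" if "y \<noteq> 0" for y :: 'a using that by simp
  have n: "(\<lambda>y. y /\<^sub>R norm y) x = x" using x by simp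
  \<comment> \<open>Euler's relation evaluates the derivative on the radial part of
    \<open>e\<close>, giving an expression that can be differentiated in \<open>y\<close> term by
    term.\<close>
  have W: "sphere_deriv \<phi> y (tan_proj y e) =
      frechet_derivative ?F (at y) e - (of_int r * (e \<bullet> y)) *\<^sub>R ?F y" if y: "norm y = 1" for y
  proof -
    have "y \<noteq> 0" using y by auto
    have "y \<bullet> tan_proj y e = 0" using y by (simp add: tan_proj_def inner_diff_right inner_commute norm_eq_1)
    then have "sphere_deriv \<phi> y (tan_proj y e) = frechet_derivative ?F (at y) (tan_proj y e)"
      using homogeneous_ext_deriv_unit[OF \<phi> y, of r] by (simp add: sphere_deriv_eq)
    also have "\<dots> = frechet_derivative ?F (at y) e - (e \<bullet> y) *\<^sub>R frechet_derivative ?F (at y) y"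
      using linear_frechet_derivative_at[OF t, of y r] \<open>y \<noteq> 0\<close>
      by (simp add: tan_proj_def linear_diff linear_scale)
    finally show ?thesis using homogeneous_ext_euler(1)[OF \<phi> \<open>y \<noteq> 0\<close>, of r] by (simp add: mult.commute)
  qed
  have dn: "((\<lambda>y. y /\<^sub>R norm y) has_derivative tan_proj x) (at x)"
    by (rule has_derivative_normalize[OF x])
  have c1: "((\<lambda>y. frechet_derivative ?F (at (y /\<^sub>R norm y)) e) has_derivative
      (\<lambda>v. second_derivative ?F x (tan_proj x v) e)) (at x)"
    using has_derivative_compose[OF dn, of "\<lambda>y. frechet_derivative ?F (at y) e"]
      twice_differentiable_onD(3)[OF t x0, of r e] by (simp add: n x)
  have c2: "((\<lambda>y. ?F (y /\<^sub>R norm y)) has_derivative (\<lambda>v. frechet_derivative ?F (at x) (tan_proj x v))) (at x)"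
    using has_derivative_compose[OF dn, of ?F] twice_differentiable_onD(2)[OF t x0, of r] by (simp add: n x)
  have c3: "((\<lambda>y. of_int r * (e \<bullet> (y /\<^sub>R norm y))) has_derivative (\<lambda>v. of_int r * (e \<bullet> tan_proj x v))) (at x)"
    by (intro has_derivative_mult_right has_derivative_inner_right dn)
  have "((\<lambda>y. frechet_derivative ?F (at (y /\<^sub>R norm y)) e - (of_int r * (e \<bullet> (y /\<^sub>R norm y))) *\<^sub>R ?F (y /\<^sub>R norm y))
      has_derivative (\<lambda>v. second_derivative ?F x (tan_proj x v) e -
        ((of_int r * (e \<bullet> (x /\<^sub>R norm x))) *\<^sub>R frechet_derivative ?F (at x) (tan_proj x v)
        + (of_int r * (e \<bullet> tan_proj x v)) *\<^sub>R ?F (x /\<^sub>R norm x)))) (at x)"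
    by (intro has_derivative_diff has_derivative_scaleR c1 c2 c3)
  then have "((\<lambda>y. sphere_deriv \<phi> (y /\<^sub>R norm y) (tan_proj (y /\<^sub>R norm y) e)) has_derivative
      (\<lambda>v. second_derivative ?F x (tan_proj x v) e -
        ((of_int r * (e \<bullet> (x /\<^sub>R norm x))) *\<^sub>R frechet_derivative ?F (at x) (tan_proj x v)
        + (of_int r * (e \<bullet> tan_proj x v)) *\<^sub>R ?F (x /\<^sub>R norm x)))) (at x)"
    by (rule has_derivative_transform_within_open[where s = "- {0}"]) (auto simp: x1 W[OF u])
  from frechet_derivative_at[OF this, symmetric]
  have "sphere_deriv (\<lambda>y. sphere_deriv \<phi> y (tan_proj y e)) x e =
      second_derivative ?F x e e - (of_int r * (e \<bullet> e)) *\<^sub>R \<phi> x"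
    unfolding sphere_deriv_def[of "\<lambda>y. sphere_deriv \<phi> y (tan_proj y e)"]
    using x e by (simp add: te homogeneous_ext_unit)
  moreover have "norm (\<phi> x) = 1" by (rule smooth_sphere_map_norm[OF \<phi> x])
  ultimately have first: "cov_deriv_along \<phi> (\<lambda>y. sphere_deriv \<phi> y (tan_proj y e)) x e =
      tan_proj (\<phi> x) (second_derivative ?F x e e)"
    by (simp add: cov_deriv_along_def tan_proj_diff_normal)
  \<comment> \<open>The derivative of the extending field in the direction \<open>e\<close> is
    normal to the sphere at \<open>x\<close>, so the correction term of the second fundamental form
    vanishes.\<close>
  have "((\<lambda>y. tan_proj (y /\<^sub>R norm y) e) has_derivative
      (\<lambda>v. 0 - ((e \<bullet> (x /\<^sub>R norm x)) *\<^sub>R tan_proj x v + (e \<bullet> tan_proj x v) *\<^sub>R (x /\<^sub>R norm x)))) (at x)"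
    unfolding tan_proj_def[of "_ /\<^sub>R _"]
    by (intro has_derivative_diff has_derivative_const has_derivative_scaleR has_derivative_inner_right dn)
  from frechet_derivative_at[OF this, symmetric]
  have "sphere_deriv (\<lambda>y. tan_proj y e) x e = - (e \<bullet> e) *\<^sub>R x"
    using x e by (simp add: sphere_deriv_def te)
  then have "cov_deriv_along (\<lambda>y. y) (\<lambda>y. tan_proj y e) x e = 0"
    using x by (simp add: cov_deriv_along_def tan_proj_def norm_eq_1)
  then have "sphere_deriv \<phi> x (cov_deriv_along (\<lambda>y. y) (\<lambda>y. tan_proj y e) x e) = 0"
    using linear_0[OF linear_frechet_derivative_at[OF t x0, of 0]] by (simp add: sphere_deriv_eq)
  then show ?thesis using first by (simp add: second_fund_form_def)
qed

lemma tangent_onb_exists: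
  fixes x :: "'a::euclidean_space"
  assumes x: "norm x = 1"
  shows "\<exists>B. tangent_onb x B"
proof -
  obtain S where S: "x \<in> S" "pairwise orthogonal S" "\<And>e. e \<in> S \<Longrightarrow> norm e = 1" "span S = UNIV"
    using vector_in_orthonormal_basis[OF x] by metis
  have ort: "e \<bullet> x = 0" if "e \<in> S - {x}" for e
    using S that by (auto simp: pairwise_def orthogonal_def)
  have fin: "finite S" using orthonormal_expansion[OF S(2-4)] by simp
  have "v \<in> span (S - {x})" if v: "v \<bullet> x = 0" for v
  proof -
    have "v = (\<Sum>e\<in>S. (v \<bullet> e) *\<^sub>R e)" using orthonormal_expansion[OF S(2-4)] by simp
    also have "\<dots> = (\<Sum>e\<in>S - {x}. (v \<bullet> e) *\<^sub>R e)"
      using v by (intro sum.mono_neutral_right fin) auto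
    also have "\<dots> \<in> span (S - {x})" by (intro span_sum span_scale span_base)
    finally show ?thesis .
  qed
  moreover have "v \<bullet> x = 0" if "v \<in> span (S - {x})" for v
    using that
    by (induction rule: span_induct_alt) (auto simp: inner_add_left ort)
  ultimately have "tangent_onb x (S - {x})"
    using S by (auto simp: tangent_onb_def pairwise_def)
  then show ?thesis by blast
qed

lemma tangent_onb_insert:
  assumes x: "norm x = 1" and B: "tangent_onb x B"
  shows "pairwise orthogonal (insert x B)" "\<And>e. e \<in> insert x B \<Longrightarrow> norm e = 1"
    "span (insert x B) = UNIV" "finite B" "x \<notin> B" "\<And>e. e \<in> B \<Longrightarrow> e \<bullet> x = 0"
proof -
  show o: "\<And>e. e \<in> B \<Longrightarrow> e \<bullet> x = 0" using B span_base by (auto simp: tangent_onb_def)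
  then show "x \<notin> B" using x by (metis inner_eq_zero_iff norm_zero zero_neq_one)
  show "pairwise orthogonal (insert x B)"
    using o B x by (auto simp: tangent_onb_def pairwise_insert orthogonal_def inner_commute)
  show "\<And>e. e \<in> insert x B \<Longrightarrow> norm e = 1" using B x by (auto simp: tangent_onb_def)
  show "finite B" using B pairwise_orthogonal_imp_finite by (auto simp: tangent_onb_def)
  have "v \<in> span (insert x B)" for v
  proof -
    have "(v - (v \<bullet> x) *\<^sub>R x) \<bullet> x = 0" using x by (simp add: inner_diff_left norm_eq_1)
    then have "v - (v \<bullet> x) *\<^sub>R x \<in> span B" using B by (simp add: tangent_onb_def)
    then show ?thesis unfolding span_insert by blast
  qed
  then show "span (insert x B) = UNIV" by blast
qed

text \<open>Adding the radial direction to a tangent basis costs nothing: by Euler's relation the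
  radial second derivative is a multiple of \<open>\<phi> x\<close>, hence orthogonal to
  \<open>v\<close>.\<close>

lemma tension_field_inner:
  assumes \<phi>: "smooth_sphere_map \<phi>" and x: "norm x = 1" and v: "\<phi> x \<bullet> v = 0"
  shows "tension_field \<phi> x \<bullet> v = (\<Sum>b\<in>Basis. second_derivative (homogeneous_ext r \<phi>) x b b \<bullet> v)"
proof -
  let ?F = "homogeneous_ext r \<phi>"
  define B where "B = (SOME B. tangent_onb x B)"
  have B: "tangent_onb x B" unfolding B_def using someI_ex[OF tangent_onb_exists[OF x]] .
  note I = tangent_onb_insert[OF x B]
  have x0: "x \<noteq> 0" using x by auto
  have bil: "bilinear (\<lambda>a b. second_derivative ?F x a b \<bullet> v)"
    using bilinear_second_derivative[OF twice_differentiable_on_homogeneous_ext[OF \<phi>], of x r] x0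
    by (subst bilinear_def) (auto intro!: linearI simp: bilinear_ladd bilinear_lmul bilinear_radd
        bilinear_rmul inner_add_left)
  have "tension_field \<phi> x \<bullet> v = (\<Sum>e\<in>B. second_fund_form \<phi> x e e \<bullet> v)"
    by (simp add: tension_field_def B_def inner_sum_left)
  also have "\<dots> = (\<Sum>e\<in>B. second_derivative ?F x e e \<bullet> v)"
    using I(6) v by (intro sum.cong refl)
      (simp add: second_fund_form_eq[OF \<phi> x, where r = r] tan_proj_def inner_diff_left)
  also have "\<dots> = (\<Sum>e\<in>insert x B. second_derivative ?F x e e \<bullet> v)"
    using I x v by (simp add: homogeneous_ext_euler[OF \<phi> x0] homogeneous_ext_unit)
  also have "\<dots> = (\<Sum>b\<in>Basis. second_derivative ?F x b b \<bullet> v)"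
    by (rule sum_orthonormal_basis[OF I(1-3) bil])
  finally show ?thesis .
qed

section \<open>Divergence and a criterion for harmonicity\<close>

definition divergence :: "('a::euclidean_space \<Rightarrow> 'a) \<Rightarrow> 'a \<Rightarrow> real" where
  "divergence f x = trace_of (frechet_derivative f (at x))"

lemma has_derivative_divergence:
  assumes "twice_differentiable_on S f" "x \<in> S"
  shows "(divergence f has_derivative (\<lambda>v. \<Sum>b\<in>Basis. second_derivative f x v b \<bullet> b)) (at x)"
  unfolding divergence_def[abs_def] trace_of_def
  by (intro has_derivative_sum has_derivative_inner_left twice_differentiable_onD(3)[OF assms])

text \<open>Differentiating \<open>sym\<close> exchanges a direction with the tested component, and
  the symmetry of second derivatives exchanges the two directions.\<close>

lemma laplacian_eq_grad_divergence:
  assumes f: "twice_differentiable_on S f" and x: "x \<in> S"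
    and sym: "\<And>y v w. y \<in> S \<Longrightarrow>
      frechet_derivative f (at y) v \<bullet> w = frechet_derivative f (at y) w \<bullet> v"
  shows "(\<Sum>b\<in>Basis. second_derivative f x b b \<bullet> v) = frechet_derivative (divergence f) (at x) v"
proof -
  have "second_derivative f x b b \<bullet> v = second_derivative f x v b \<bullet> b" for b
  proof -
    have "((\<lambda>y. frechet_derivative f (at y) v \<bullet> b) has_derivative (\<lambda>u. second_derivative f x u b \<bullet> v)) (at x)"
      by (rule has_derivative_transform_within_open[OF has_derivative_inner_left[OF
          twice_differentiable_onD(3)[OF f x]] twice_differentiable_onD(1)[OF f x] x]) (simp add: sym)
    from fun_cong[OF has_derivative_unique[OF this has_derivative_inner_left[OF twice_differentiable_onD(3)[OF f x]]]]
    have "second_derivative f x b b \<bullet> v = second_derivative f x b v \<bullet> b" by simp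
    then show ?thesis using symmetric_second_derivative[OF f x] by simp
  qed
  then show ?thesis using frechet_derivative_at[OF has_derivative_divergence[OF f x], symmetric] by simp
qed

lemma tension_field_orthogonal:
  assumes \<phi>: "smooth_sphere_map \<phi>" and x: "norm x = 1"
  shows "tension_field \<phi> x \<bullet> \<phi> x = 0"
proof -
  define B where "B = (SOME B. tangent_onb x B)"
  have B: "tangent_onb x B" unfolding B_def using someI_ex[OF tangent_onb_exists[OF x]] .
  have "norm (\<phi> x) = 1" by (rule smooth_sphere_map_norm[OF \<phi> x])
  then have "second_fund_form \<phi> x e e \<bullet> \<phi> x = 0" if "e \<in> B" for e
    using tangent_onb_insert(6)[OF x B that]
    by (simp add: second_fund_form_eq[OF \<phi> x, where r = 0] tan_proj_def inner_diff_left norm_eq_1)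
  then show ?thesis by (simp add: tension_field_def B_def[symmetric] inner_sum_left)
qed

text \<open>The tension is tangent at \<open>\<phi> x\<close>, so it is tested against the vectors
  orthogonal to \<open>\<phi> x\<close>; these need not be tangent at \<open>x\<close>.\<close>

lemma harmonic_iff_grad_divergence:
  assumes \<phi>: "smooth_sphere_map \<phi>"
    and sym: "\<And>y v w. y \<noteq> 0 \<Longrightarrow> frechet_derivative (homogeneous_ext r \<phi>) (at y) v \<bullet> w =
      frechet_derivative (homogeneous_ext r \<phi>) (at y) w \<bullet> v"
  shows "harmonic \<phi> \<longleftrightarrow> (\<forall>x v. norm x = 1 \<and> \<phi> x \<bullet> v = 0 \<longrightarrow>
    frechet_derivative (divergence (homogeneous_ext r \<phi>)) (at x) v = 0)"
proof -
  have main: "tension_field \<phi> x \<bullet> v = frechet_derivative (divergence (homogeneous_ext r \<phi>)) (at x) v"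
    if "norm x = 1" "\<phi> x \<bullet> v = 0" for x v
    using tension_field_inner[OF \<phi> that, of r]
      laplacian_eq_grad_divergence[OF twice_differentiable_on_homogeneous_ext[OF \<phi>], of x r v] sym that
    by force
  have "tension_field \<phi> x = 0 \<longleftrightarrow> (\<forall>v. \<phi> x \<bullet> v = 0 \<longrightarrow> tension_field \<phi> x \<bullet> v = 0)"
    if "norm x = 1" for x
    using tension_field_orthogonal[OF \<phi> that] by (metis inner_commute inner_eq_zero_iff inner_zero_left)
  then show ?thesis unfolding harmonic_def using main by (metis dist_0_norm mem_sphere)
qed

section \<open>Trigonometric sums\<close>

text \<open>Each summand is \<open>1 / (1 - w ^ N)\<close> times a finite geometric series in
  \<open>w * z ^ i\<close>, with \<open>z\<close> a primitive root of unity. Summing over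
  \<open>i\<close> first, every power \<open>l > 0\<close> cancels.\<close>

lemma sum_roots_of_unity_inverse:
  fixes w :: complex
  assumes N: "N > 0" and w: "w ^ N \<noteq> 1"
  shows "(\<Sum>i<N. 1 / (1 - w * cis (2 * pi * real i / real N))) = of_nat N / (1 - w ^ N)"
proof -
  define z where "z = cis (2 * pi / real N)"
  have "z ^ N = cis (real N * (2 * pi / real N))" unfolding z_def by (rule Complex.DeMoivre)
  then have zN: "z ^ N = 1" using N by simp
  have pow1: "(z ^ l) ^ N = 1" for l
    using power_mult[of z l N] power_mult[of z N l] zN by (simp only: mult.commute[of l N]) simp
  have zi: "cis (2 * pi * real i / real N) = z ^ i" for i
    by (simp add: z_def Complex.DeMoivre mult.commute)
  have zl: "z ^ l \<noteq> 1" if "0 < l" "l < N" for l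
  proof -
    have "z ^ l = exp (2 * of_real pi * \<i> * of_nat l / of_nat N)"
      by (simp add: zi[symmetric] cis_conv_exp mult_ac)
    then show ?thesis using complex_root_unity_eq_1[of N l] N that by (auto dest: dvd_imp_le)
  qed
  have geo: "(\<Sum>i<N. (z ^ l) ^ i) = 0" if "0 < l" "l < N" for l
  proof -
    have "(z ^ l) ^ N = 1" by (rule pow1)
    then show ?thesis using sum_gp_strict[of "z ^ l" N] zl[OF that] by simp
  qed
  have each: "(1 - w ^ N) * (1 / (1 - w * z ^ i)) = (\<Sum>l<N. w ^ l * (z ^ l) ^ i)" for i
  proof -
    have pN: "(w * z ^ i) ^ N = w ^ N"
      unfolding power_mult_distrib pow1 by simp
    then have "w * z ^ i \<noteq> 1" using w by auto
    then have "(\<Sum>l<N. (w * z ^ i) ^ l) = (1 - w ^ N) / (1 - w * z ^ i)"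
      using sum_gp_strict[of "w * z ^ i" N] pN by simp
    moreover have "(w * z ^ i) ^ l = w ^ l * (z ^ l) ^ i" for l
      unfolding power_mult_distrib power_mult[symmetric] by (simp only: mult.commute[of i l])
    ultimately show ?thesis by simp
  qed
  have "(1 - w ^ N) * (\<Sum>i<N. 1 / (1 - w * z ^ i)) = (\<Sum>i<N. \<Sum>l<N. w ^ l * (z ^ l) ^ i)"
    unfolding sum_distrib_left each ..
  also have "\<dots> = (\<Sum>l<N. w ^ l * (\<Sum>i<N. (z ^ l) ^ i))"
    by (subst sum.swap) (simp add: sum_distrib_left)
  also have "\<dots> = (\<Sum>l<N. if l = 0 then of_nat N else 0)"
    using geo by (intro sum.cong) auto
  also have "\<dots> = of_nat N" using N by simp
  finally have "(1 - w ^ N) * (\<Sum>i<N. 1 / (1 - w * z ^ i)) = of_nat N" .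
  then show ?thesis using w unfolding zi by (metis eq_divide_imp mult.commute right_minus_eq)
qed

text \<open>Expresses the cotangent by a rational function on the unit circle, so that sums over
  shifted angles become sums over roots of unity.\<close>

lemma cot_eq_Im: "cot y = - 2 * Im (1 / (1 - cis (- 2 * y)))"
proof (cases "sin y = 0")
  \<comment> \<open>At a pole both sides are \<open>0\<close>, since division by zero yields
    \<open>0\<close>.\<close>
  case True
  then have "cis (- 2 * y) = 1" by (simp add: complex_eq_iff cos_double_sin sin_double)
  then show ?thesis using True by (simp add: cot_def)
next
  case False
  have "1 - cis (- 2 * y) = Complex (2 * (sin y)\<^sup>2) (2 * sin y * cos y)"
    by (simp add: complex_eq_iff cos_double_sin sin_double)
  also have "\<dots> * Complex (1 / 2) (- (cos y / (2 * sin y))) = 1"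
    using False sin_cos_squared_add[of y] by (simp add: complex_eq_iff power2_eq_square)
  finally have "1 / (1 - cis (- 2 * y)) = Complex (1 / 2) (- (cos y / (2 * sin y)))"
    by (metis divide_eq_eq mult.commute mult_zero_left zero_neq_one)
  then show ?thesis by (simp add: cot_def)
qed

text \<open>With \<open>w = cis (- 2 * x)\<close>, shifting the angle by \<open>i * pi / N\<close>
  multiplies \<open>w\<close> by an \<open>N\<close>-th root of unity.\<close>

lemma sum_cot:
  assumes N: "N > 0" and x: "sin (real N * x) \<noteq> 0"
  shows "(\<Sum>i<N. cot (x - real i * pi / real N)) = real N * cot (real N * x)"
proof -
  define w where "w = cis (- 2 * x)"
  have wN: "w ^ N = cis (- 2 * (real N * x))" by (simp add: w_def Complex.DeMoivre mult_ac)
  have "w ^ N \<noteq> 1"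
  proof
    assume "w ^ N = 1"
    then have "cos (2 * (real N * x)) = 1" unfolding wN by (simp add: complex_eq_iff)
    then show False using x by (simp add: cos_double_sin)
  qed
  note * = sum_roots_of_unity_inverse[OF N this]
  have Im_of_nat: "Im (of_nat N * c) = real N * Im c" for c by simp
  have "w * cis (2 * pi * real i / real N) = cis (- 2 * (x - real i * pi / real N))" for i
    by (simp add: w_def cis_mult algebra_simps)
  then have "(\<Sum>i<N. cot (x - real i * pi / real N)) = - 2 * Im (\<Sum>i<N. 1 / (1 - w * cis (2 * pi * real i / real N)))"
    by (simp add: cot_eq_Im sum_distrib_left)
  also have "\<dots> = - 2 * Im (of_nat N * (1 / (1 - cis (- 2 * (real N * x)))))"
    unfolding * wN by simp
  also have "\<dots> = real N * cot (real N * x)"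
    unfolding cot_eq_Im[of "real N * x"] Im_of_nat by (simp only: mult.left_commute)
  finally show ?thesis .
qed

lemma sum_lessThan_double:
  fixes f :: "nat \<Rightarrow> 'a::comm_monoid_add"
  shows "(\<Sum>i<2 * N. f i) = (\<Sum>l<N. f (2 * l)) + (\<Sum>l<N. f (2 * l + 1))"
  by (induction N) (simp_all add: add_ac)

lemma cot_minus_tan:
  assumes "sin (2 * u) \<noteq> (0::real)"
  shows "cot u - tan u = 2 * cot (2 * u)"
proof -
  have "sin u \<noteq> 0" "cos u \<noteq> 0" using assms by (auto simp: sin_double)
  then show ?thesis
    unfolding cot_def tan_def sin_double cos_double power2_eq_square by (simp add: field_simps)
qed

lemma sum_parity_mult:
  assumes "odd g \<Longrightarrow> m0 = m1"
  shows "(\<Sum>i<g. real (parity_mult m0 m1 i)) = real g / 2 * (real m0 + real m1)"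
proof (cases "even g")
  case True
  then obtain N where N: "g = 2 * N" by blast
  show ?thesis unfolding N sum_lessThan_double by (simp add: parity_mult_def algebra_simps)
next
  case False
  then show ?thesis using assms by (simp add: parity_mult_def)
qed

text \<open>For \<open>g = 2 * N\<close> the even and the odd indices form two cotangent sums of
  step \<open>pi / N\<close>. In the odd one the scaled angle is shifted by \<open>pi / 2\<close>,
  which turns \<open>cot\<close> into \<open>- tan\<close>. For odd \<open>g\<close> the
  multiplicities agree, and \<open>cot_minus_tan\<close> gives the single sum the same
  shape.\<close>

lemma sum_parity_cot:
  assumes g: "odd g \<Longrightarrow> m0 = m1" "g > 0" and t: "sin (real g * t) \<noteq> 0"
  shows "(\<Sum>i<g. real (parity_mult m0 m1 i) * cot (t - real i * pi / real g)) =
    real g / 2 * (real m0 * cot (real g * t / 2) - real m1 * tan (real g * t / 2))"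
proof (cases "even g")
  case True
  then obtain N where N: "g = 2 * N" by blast
  then have "N > 0" using g by simp
  have s: "sin (real N * t) \<noteq> 0"
    using t sin_double[of "real N * t"] by (auto simp: N mult.assoc)
  have c: "cos (real N * t) \<noteq> 0"
    using t sin_double[of "real N * t"] by (auto simp: N mult.assoc)
  have p: "real N * (t - pi / real g) = real N * t - pi / 2"
    using \<open>N > 0\<close> by (simp add: N right_diff_distrib)
  have "sin (real N * (t - pi / real g)) \<noteq> 0"
    unfolding p using c by (simp add: sin_diff)
  then have "(\<Sum>l<N. cot (t - pi / real g - real l * pi / real N)) = real N * cot (real N * (t - pi / real g))"
    using \<open>N > 0\<close> by (intro sum_cot)
  also have "cot (real N * (t - pi / real g)) = - tan (real N * t)"
    unfolding p by (simp add: cot_def tan_def sin_diff cos_diff)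
  finally have od: "(\<Sum>l<N. cot (t - pi / real g - real l * pi / real N)) = - real N * tan (real N * t)" by simp
  have ev: "(\<Sum>l<N. cot (t - real l * pi / real N)) = real N * cot (real N * t)"
    by (rule sum_cot[OF \<open>N > 0\<close> s])
  have e1: "real (parity_mult m0 m1 (2 * l)) * cot (t - real (2 * l) * pi / real (2 * N)) =
      real m0 * cot (t - real l * pi / real N)" for l
    by (simp add: parity_mult_def)
  have "real (2 * l + 1) * pi / real (2 * N) = pi / real (2 * N) + real l * pi / real N" for l
    using \<open>N > 0\<close> by (simp add: add_divide_distrib distrib_right)
  then have e2: "real (parity_mult m0 m1 (2 * l + 1)) * cot (t - real (2 * l + 1) * pi / real (2 * N)) =
      real m1 * cot (t - pi / real g - real l * pi / real N)" for l
    by (simp only: N diff_diff_eq) (simp add: parity_mult_def)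
  have "(\<Sum>i<g. real (parity_mult m0 m1 i) * cot (t - real i * pi / real g)) =
      real m0 * (\<Sum>l<N. cot (t - real l * pi / real N)) +
      real m1 * (\<Sum>l<N. cot (t - pi / real g - real l * pi / real N))"
    unfolding sum_distrib_left e1[symmetric] e2[symmetric] by (simp only: N sum_lessThan_double)
  then show ?thesis unfolding od ev by (simp add: N right_diff_distrib)
next
  case False
  then have "m0 = m1" using g by simp
  then have "(\<Sum>i<g. real (parity_mult m0 m1 i) * cot (t - real i * pi / real g)) =
      real m0 * (\<Sum>i<g. cot (t - real i * pi / real g))"
    by (simp add: parity_mult_def sum_distrib_left)
  also have "\<dots> = real m0 * real g / 2 * (2 * cot (2 * (real g * t / 2)))"
    by (simp add: sum_cot[OF g(2) t])
  also have "\<dots> = real m0 * real g / 2 * (cot (real g * t / 2) - tan (real g * t / 2))"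
    by (subst cot_minus_tan) (use t in auto)
  finally show ?thesis using \<open>m0 = m1\<close> by (simp add: algebra_simps)
qed

section \<open>The divergence as a function of the geodesic parameter\<close>

text \<open>For \<open>d = 1 - k\<close> this is the divergence, at \<open>\<gamma> t\<close>, of
  the extension of degree \<open>- k\<close>. The half angles separate the two parities:
  \<open>cot\<close> is singular at \<open>t = 0\<close>, \<open>tan\<close> at
  \<open>t = pi / g\<close>.\<close>

definition div_profile :: "nat \<Rightarrow> nat \<Rightarrow> nat \<Rightarrow> real \<Rightarrow> real \<Rightarrow> real" where
  "div_profile g m0 m1 d t = real g / 2 * ((real m0 + real m1) * cos (d * t) -
     sin (d * t) * (real m0 * cot (real g * t / 2) - real m1 * tan (real g * t / 2)))"

lemma sin_shift_nonzero:
  assumes g: "g > 0" and t: "sin (real g * t) \<noteq> 0"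
  shows "sin (t - of_int i * pi / real g) \<noteq> 0"
proof
  assume "sin (t - of_int i * pi / real g) = 0"
  then obtain l :: int where "t - of_int i * pi / real g = of_int l * pi"
    by (auto simp: sin_zero_iff_int2)
  then have "real g * t = of_int (int g * l + i) * pi"
    using g by (simp add: field_simps)
  then show False using t sin_zero_iff_int2 by blast
qed

text \<open>By the addition theorem each ratio is
  \<open>cos (d * t) - sin (d * t) * cot (t - \<theta>)\<close> with
  \<open>\<theta> = i * pi / g\<close>. The ratios are the eigenvalues of the derivative of the
  extension.\<close>

lemma sum_sin_ratio:
  assumes g: "odd g \<Longrightarrow> m0 = m1" "g > 0" and t: "sin (real g * t) \<noteq> 0"
  shows "(\<Sum>i<g. real (parity_mult m0 m1 i) *
      (sin ((1 - d) * t - real i * pi / real g) / sin (t - real i * pi / real g))) =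
    div_profile g m0 m1 d t"
proof -
  have S: "(\<Sum>i<g. real (parity_mult m0 m1 i)) = real g / 2 * (real m0 + real m1)"
    using g(1) by (rule sum_parity_mult)
  have C: "(\<Sum>i<g. real (parity_mult m0 m1 i) * cot (t - real i * pi / real g)) =
      real g / 2 * (real m0 * cot (real g * t / 2) - real m1 * tan (real g * t / 2))"
    using g t by (rule sum_parity_cot)
  have eq: "sin ((1 - d) * t - real i * pi / real g) / sin (t - real i * pi / real g) =
      cos (d * t) - sin (d * t) * cot (t - real i * pi / real g)" for i
  proof -
    have "sin (t - real i * pi / real g) \<noteq> 0" using sin_shift_nonzero[OF g(2) t, of "int i"] by simp
    moreover have "(1 - d) * t - real i * pi / real g = (t - real i * pi / real g) - d * t"
      by (simp add: algebra_simps)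
    ultimately show ?thesis by (simp only: sin_diff[of "t - real i * pi / real g"]) (simp add: cot_def field_simps)
  qed
  have "(\<Sum>i<g. real (parity_mult m0 m1 i) *
      (sin ((1 - d) * t - real i * pi / real g) / sin (t - real i * pi / real g))) =
    cos (d * t) * (\<Sum>i<g. real (parity_mult m0 m1 i)) -
    sin (d * t) * (\<Sum>i<g. real (parity_mult m0 m1 i) * cot (t - real i * pi / real g))"
    unfolding eq sum_distrib_left sum_subtractf[symmetric]
    by (intro sum.cong refl) (simp add: right_diff_distrib)
  also have "\<dots> = div_profile g m0 m1 d t"
    unfolding S C div_profile_def by (simp add: algebra_simps)
  finally show ?thesis .
qed

text \<open>For equal multiplicities the bracket collapses to \<open>2 * m * cot (g * t)\<close>.
  The value \<open>d = g\<close> is the harmonic case \<open>k = 1 - g\<close>;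
  \<open>d = - g\<close> passes the test at the zero of the cosine and has to be refuted
  separately.\<close>

lemma div_profile_equal_mult:
  assumes "sin (real g * t) \<noteq> 0"
  shows "div_profile g m m (real g) t = 0"
    and "div_profile g m m (- real g) t = 2 * real g * real m * cos (real g * t)"
proof -
  have "real m * cot (real g * t / 2) - real m * tan (real g * t / 2) = real m * (2 * cot (real g * t))"
    using cot_minus_tan[of "real g * t / 2"] assms by (simp add: right_diff_distrib[symmetric])
  then show "div_profile g m m (real g) t = 0"
    "div_profile g m m (- real g) t = 2 * real g * real m * cos (real g * t)"
    using assms by (simp_all add: div_profile_def cot_def)
qed

text \<open>The case \<open>g = 2\<close>, \<open>k = -1\<close>: the divergence is constant along
  the geodesic, though it may be nonzero.\<close>

lemma div_profile_two:
  assumes "sin (2 * t) \<noteq> 0"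
  shows "div_profile 2 m0 m1 2 t = real m1 - real m0"
proof -
  have nz: "sin t \<noteq> 0" "cos t \<noteq> 0" using assms by (auto simp: sin_double)
  have "sin (2 * t) * cot t = 2 * (cos t)\<^sup>2" "sin (2 * t) * tan t = 2 * (sin t)\<^sup>2"
    using nz by (simp_all add: sin_double cot_def tan_def power2_eq_square)
  then have "div_profile 2 m0 m1 2 t = (real m0 + real m1) * cos (2 * t) - real m0 * (2 * (cos t)\<^sup>2) + real m1 * (2 * (sin t)\<^sup>2)"
    by (simp add: div_profile_def algebra_simps)
  also have "\<dots> = real m1 - real m0"
  proof -
    have "(cos t)\<^sup>2 = 1 - (sin t)\<^sup>2" by (simp add: cos_squared_eq)
    then have "real m0 * (cos t)\<^sup>2 = real m0 * (1 - (sin t)\<^sup>2)" "real m1 * (cos t)\<^sup>2 = real m1 * (1 - (sin t)\<^sup>2)" by simp_all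
    then show ?thesis unfolding cos_double by (simp add: algebra_simps)
  qed
  finally show ?thesis .
qed

text \<open>Where the cosine vanishes only the bracket survives; it is multiplied by the tangent,
  which is positive on this interval.\<close>

lemma div_profile_zero:
  assumes g: "g > 0" and t: "0 < t" "t < pi / real g" and c: "cos (d * t) = 0"
    and z: "div_profile g m0 m1 d t = 0"
  shows "real m0 = real m1 * (tan (real g * t / 2))\<^sup>2"
proof -
  have "sin (d * t) \<noteq> 0" using c sin_cos_squared_add[of "d * t"] by force
  then have "real m0 * cot (real g * t / 2) = real m1 * tan (real g * t / 2)"
    using z c g by (simp add: div_profile_def)
  moreover have "0 < tan (real g * t / 2)"
    using t g by (intro tan_gt_zero) (auto simp: field_simps)
  then have "cot (real g * t / 2) * tan (real g * t / 2) = 1" by (simp add: cot_altdef)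
  then have "real m0 = (real m0 * cot (real g * t / 2)) * tan (real g * t / 2)" by (simp only: mult.assoc)
  ultimately show ?thesis by (simp only: power2_eq_square mult.assoc)
qed

text \<open>The hypothesis \<open>ode\<close> is the vanishing of the tension field along the normal geodesic.  At a
  zero of \<open>cos (d * t)\<close> it forces \<open>q\<close> to vanish, and \<open>div_profile\<close> can do so at one point only.\<close>

lemma ode_imp_equal_mult:
  fixes q q' :: "real \<Rightarrow> real" and J :: int
  assumes g: "g > 0" and m: "m0 > 0" "m1 > 0" and d: "d = of_int J * real g" "J \<noteq> 0" "d \<noteq> 2"
    and q: "\<And>t. 0 < t \<Longrightarrow> t < pi / real g \<Longrightarrow> sin (d * t) \<noteq> 0 \<Longrightarrow> q t = div_profile g m0 m1 d t"
    and q': "\<And>t. 0 < t \<Longrightarrow> t < pi / real g \<Longrightarrow> (q has_real_derivative q' t) (at t)"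
    and ode: "\<And>t. 0 < t \<Longrightarrow> t < pi / real g \<Longrightarrow> (2 - d) * q t * sin (d * t) = q' t * cos (d * t)"
  shows "J = 1 \<and> m0 = m1"
proof -
  have tan2: "real m0 = real m1 * (tan (real g * t / 2))\<^sup>2"
    if t: "0 < t" "t < pi / real g" and c: "cos (d * t) = 0" for t
  proof (rule div_profile_zero[OF g t c])
    have s: "sin (d * t) \<noteq> 0" using c sin_cos_squared_add[of "d * t"] by force
    then have "q t = 0" using ode[OF t] c d(3) by simp
    then show "div_profile g m0 m1 d t = 0" using q[OF t s] by simp
  qed
  \<comment> \<open>The cosine is even, so its zeros may be computed with the positive frequency
    \<open>D\<close>.\<close>
  define D where "D = of_int \<bar>J\<bar> * real g"
  have D: "D > 0" "D = \<bar>d\<bar>" using g d by (simp_all add: D_def abs_mult)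
  have cosD: "cos (d * t) = cos (D * t)" for t
    unfolding D(2) by (cases "d \<ge> 0") simp_all
  have J1: "\<bar>J\<bar> = 1"
  proof (rule ccontr)
    assume "\<bar>J\<bar> \<noteq> 1"
    then have "\<bar>J\<bar> \<ge> 2" using d(2) by linarith
    then have "of_int \<bar>J\<bar> \<ge> (2::real)" by linarith
    then have D2: "D \<ge> 2 * real g" unfolding D_def by (intro mult_right_mono) auto
    \<comment> \<open>These are the first two positive zeros of \<open>cos (D * t)\<close>; the
      second stays below \<open>pi / g\<close> because \<open>D \<ge> 2 * g\<close>.\<close>
    define a b where "a = pi / (2 * D)" and "b = 3 * pi / (2 * D)"
    have "D * a = pi / 2" "D * b = 3 / 2 * pi" using D by (simp_all add: a_def b_def)
    then have c: "cos (d * a) = 0" "cos (d * b) = 0" unfolding cosD by (simp_all only: cos_pi_half cos_3over2_pi)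
    have ab: "0 < a" "a < b" "b < pi / real g"
      using D D2 g by (simp_all add: a_def b_def field_simps)
    have "real m1 * (tan (real g * a / 2))\<^sup>2 = real m1 * (tan (real g * b / 2))\<^sup>2"
      using tan2[of a] tan2[of b] ab c by (metis less_trans)
    then have "(tan (real g * a / 2))\<^sup>2 = (tan (real g * b / 2))\<^sup>2" using m by simp
    moreover have gab: "0 < real g * a" "real g * a < real g * b" "real g * b < pi"
      using ab g by (simp_all add: field_simps)
    then have "0 < tan (real g * a / 2)" by (intro tan_gt_zero) auto
    moreover have "tan (real g * a / 2) < tan (real g * b / 2)"
      using gab by (intro tan_monotone) auto
    ultimately show False by (metis less_irrefl order_less_imp_le power2_eq_imp_eq less_trans)
  qed
  \<comment> \<open>Now \<open>D = g\<close>, and the zero of the cosine is the midpoint of the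
    interval, where the tangent of the half angle is \<open>1\<close>.\<close>
  define a where "a = pi / (2 * real g)"
  have a: "0 < a" "a < pi / real g" using g by (simp_all add: a_def field_simps)
  have "cos (d * a) = 0" using J1 g unfolding cosD D_def a_def by simp
  from tan2[OF a this] have eq: "m0 = m1" using g by (simp add: a_def tan_45)
  have "J \<noteq> - 1"
  proof
    assume "J = - 1"
    then have dg: "d = - real g" using d by simp
    \<comment> \<open>A parameter at which sine and cosine of \<open>g * t\<close> are both nonzero,
      while the differential equation would make their product vanish.\<close>
    define b where "b = pi / (4 * real g)"
    have b: "0 < b" "b < pi / real g" using g by (simp_all add: b_def field_simps)
    have s: "sin (real g * t) > 0" if "0 < t" "t < pi / real g" for t
      using that g by (intro sin_gt_zero) (auto simp: field_simps)
    have qeq: "q t = 2 * real g * real m1 * cos (real g * t)" if t: "0 < t" "t < pi / real g" for t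
      using q[OF t] s[OF t] div_profile_equal_mult(2)[of g t m1] by (simp add: dg eq)
    moreover have "((\<lambda>t. 2 * real g * real m1 * cos (real g * t)) has_real_derivative
        - 2 * real g * real g * real m1 * sin (real g * b)) (at b)"
      by (auto intro!: derivative_eq_intros)
    ultimately have "(q has_real_derivative - 2 * real g * real g * real m1 * sin (real g * b)) (at b)"
      using b has_field_derivative_transform_within_open[of _ _ b "{0<..<pi / real g}" q] by force
    then have "q' b = - 2 * real g * real g * real m1 * sin (real g * b)"
      using q'[OF b] DERIV_unique by blast
    moreover have "(2 + real g) * q b * - sin (real g * b) = q' b * cos (real g * b)"
      using ode[OF b] by (simp only: dg mult_minus_left sin_minus cos_minus diff_minus_eq_add)
    ultimately have "(2 + real g) * (2 * real g * real m1 * cos (real g * b)) * sin (real g * b) =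
        2 * real g * real g * real m1 * sin (real g * b) * cos (real g * b)"
      using qeq[OF b] by algebra
    then have "4 * real g * real m1 * cos (real g * b) * sin (real g * b) = 0" by algebra
    moreover have "real g * b = pi / 4" using g by (simp add: b_def)
    then have "cos (real g * b) > 0" by (simp only: cos_45) simp
    ultimately show False using s[OF b] g m by simp
  qed
  then show ?thesis using J1 eq by linarith
qed

section \<open>Great circles, eigenspaces and divergence\<close>

lemma span_orthonormal_card:
  fixes S :: "'a::euclidean_space set"
  assumes "pairwise orthogonal S" "\<And>e. e \<in> S \<Longrightarrow> norm e = 1" "card S = DIM('a)"
  shows "span S = UNIV"
proof -
  have "0 \<notin> S" using assms(2) by force
  then have "independent S" using assms(1) pairwise_orthogonal_independent by blast
  then show ?thesis using assms(3) by (metis dim_UNIV independent_card_le dim_eq_card_independent dim_eq_full)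
qed

text \<open>Orthonormal bases of the spaces \<open>V i\<close>, completed by \<open>a\<close> and
  \<open>b\<close>, have the right cardinality to span everything. The vectors \<open>a\<close> and
  \<open>b\<close>, later the position and velocity of the geodesic, need not be
  eigenvectors.\<close>

lemma trace_of_eigenspaces:
  fixes L :: "'a::euclidean_space \<Rightarrow> 'a" and V :: "nat \<Rightarrow> 'a set"
  assumes L: "linear L"
    and V: "\<And>i. i < g \<Longrightarrow> subspace (V i)"
    and orth: "\<And>i j v w. i < g \<Longrightarrow> j < g \<Longrightarrow> i \<noteq> j \<Longrightarrow> v \<in> V i \<Longrightarrow> w \<in> V j \<Longrightarrow> v \<bullet> w = 0"
    and ab: "norm a = 1" "norm b = 1" "a \<bullet> b = 0"
      "\<And>i v. i < g \<Longrightarrow> v \<in> V i \<Longrightarrow> v \<bullet> a = 0" "\<And>i v. i < g \<Longrightarrow> v \<in> V i \<Longrightarrow> v \<bullet> b = 0"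
    and eig: "\<And>i v. i < g \<Longrightarrow> v \<in> V i \<Longrightarrow> L v = \<alpha> i *\<^sub>R v"
    and dim: "(\<Sum>i<g. dim (V i)) + 2 = DIM('a)"
  shows "trace_of L = (\<Sum>i<g. real (dim (V i)) * \<alpha> i) + (L a \<bullet> a + L b \<bullet> b)"
proof -
  have "\<exists>B. B \<subseteq> V i \<and> pairwise orthogonal B \<and> (\<forall>e\<in>B. norm e = 1) \<and> card B = dim (V i) \<and> finite B"
    if "i < g" for i
    using orthonormal_basis_subspace[OF V[OF that]] by (metis independent_imp_finite)
  then obtain B where B: "\<And>i. i < g \<Longrightarrow> B i \<subseteq> V i" "\<And>i. i < g \<Longrightarrow> pairwise orthogonal (B i)"
    "\<And>i e. i < g \<Longrightarrow> e \<in> B i \<Longrightarrow> norm e = 1" "\<And>i. i < g \<Longrightarrow> card (B i) = dim (V i)"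
    "\<And>i. i < g \<Longrightarrow> finite (B i)"
    by metis
  define W where "W = (\<Union>i<g. B i)"
  have disj: "B i \<inter> B j = {}" if ij: "i < g" "j < g" "i \<noteq> j" for i j
  proof (rule ccontr)
    assume "B i \<inter> B j \<noteq> {}"
    then obtain e where e: "e \<in> B i" "e \<in> B j" by blast
    then have "e \<bullet> e = 0" using orth[OF ij] B(1) ij by blast
    then show False using B(3)[OF ij(1) e(1)] by simp
  qed
  have cardW: "card W = (\<Sum>i<g. dim (V i))"
    unfolding W_def using B(4,5) disj by (subst card_UN_disjoint) auto
  have finW: "finite W" unfolding W_def using B(5) by auto
  have W: "w \<bullet> a = 0" "w \<bullet> b = 0" "norm w = 1" if wW: "w \<in> W" for w
  proof -
    obtain i where i: "i < g" "w \<in> B i" using wW by (auto simp: W_def)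
    then have "w \<in> V i" using B(1) by blast
    then show "w \<bullet> a = 0" "w \<bullet> b = 0" "norm w = 1" using ab i B(3) by blast+
  qed
  have ne: "a \<notin> W" "b \<notin> W" "a \<noteq> b" using W ab by (force simp: norm_eq_1)+
  have oW: "pairwise orthogonal W"
  proof (rule pairwiseI)
    fix v w assume vw: "v \<in> W" "w \<in> W" "v \<noteq> w"
    then obtain i j where ij: "i < g" "j < g" "v \<in> B i" "w \<in> B j" unfolding W_def by auto
    show "orthogonal v w"
    proof (cases "i = j")
      case True
      then show ?thesis using B(2)[OF ij(1)] ij vw by (auto simp: pairwise_def)
    next
      case False
      then show ?thesis using orth[OF ij(1,2)] B(1) ij by (auto simp: orthogonal_def)
    qed
  qed
  define S where "S = insert a (insert b W)"
  have oS: "pairwise orthogonal S"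
    using oW W ab(3) by (auto simp: S_def pairwise_insert orthogonal_def inner_commute)
  have nS: "\<And>e. e \<in> S \<Longrightarrow> norm e = 1" using W ab by (auto simp: S_def)
  have "card S = DIM('a)" using ne finW cardW dim by (simp add: S_def)
  from trace_of_orthonormal[OF oS nS span_orthonormal_card[OF oS nS this] L]
  have "trace_of L = (\<Sum>e\<in>W. L e \<bullet> e) + (L a \<bullet> a + L b \<bullet> b)"
    using ne finW by (simp add: S_def)
  also have "(\<Sum>e\<in>W. L e \<bullet> e) = (\<Sum>i<g. \<Sum>e\<in>B i. L e \<bullet> e)"
    unfolding W_def using B(5) disj by (intro sum.UNION_disjoint) auto
  also have "\<dots> = (\<Sum>i<g. real (dim (V i)) * \<alpha> i)"
  proof (rule sum.cong[OF refl])
    fix i assume "i \<in> {..<g}"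
    then have i: "i < g" by simp
    have "L e \<bullet> e = \<alpha> i" if e: "e \<in> B i" for e
    proof -
      have "e \<bullet> e = 1" using B(3)[OF i e] by (simp add: norm_eq_1)
      then show ?thesis using eig[OF i, of e] B(1)[OF i] e by auto
    qed
    then show "(\<Sum>e\<in>B i. L e \<bullet> e) = real (dim (V i)) * \<alpha> i" using B(4)[OF i] by simp
  qed
  finally show ?thesis .
qed

text \<open>A count of orthonormal vectors. It reduces linear identities at a principal point to the
  position, the velocity and the orbit directions.\<close>

lemma span_insert2_eq_UNIV:
  fixes V :: "'a::euclidean_space set"
  assumes ab: "norm a = 1" "norm b = 1" "a \<bullet> b = 0"
    and V: "\<And>v. v \<in> V \<Longrightarrow> v \<bullet> a = 0" "\<And>v. v \<in> V \<Longrightarrow> v \<bullet> b = 0"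
    and dim: "dim V + 2 = DIM('a)"
  shows "span (insert a (insert b V)) = UNIV"
proof -
  obtain B where B: "B \<subseteq> span V" "pairwise orthogonal B" "\<And>e. e \<in> B \<Longrightarrow> norm e = 1"
    "independent B" "card B = dim V"
    using orthonormal_basis_subspace[OF subspace_span, of V] by (metis dim_span)
  have fin: "finite B" using B(4) by (rule independent_imp_finite)
  have sV: "v \<bullet> a = 0" "v \<bullet> b = 0" if "v \<in> span V" for v
    using that by (induction rule: span_induct_alt) (auto simp: inner_add_left V)
  then have W: "w \<bullet> a = 0" "w \<bullet> b = 0" if "w \<in> B" for w using that B(1) by auto
  have ne: "a \<notin> B" "b \<notin> B" "a \<noteq> b" using W ab by (force simp: norm_eq_1)+
  have "pairwise orthogonal (insert a (insert b B))"
    using B(2) W ab(3) by (auto simp: pairwise_insert orthogonal_def inner_commute)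
  then have "span (insert a (insert b B)) = UNIV"
    using ne fin B ab dim by (intro span_orthonormal_card) auto
  moreover have "insert a (insert b B) \<subseteq> span (insert a (insert b V))"
    using B(1) span_mono[of V "insert a (insert b V)"] by (auto intro: span_base)
  ultimately show ?thesis by (metis span_mono span_span top.extremum_uniqueI)
qed

lemma has_vector_derivative_along:
  assumes "(f has_derivative f') (at (c t))" "(c has_vector_derivative w) (at t)"
  shows "((\<lambda>s. f (c s)) has_vector_derivative f' w) (at t)"
proof -
  have "((\<lambda>s. f (c s)) has_derivative (\<lambda>s. f' (s *\<^sub>R w))) (at t)"
    using has_derivative_compose[OF assms(2)[unfolded has_vector_derivative_def] assms(1)] .
  then show ?thesis
    unfolding has_vector_derivative_def
    using linear_scale[OF has_derivative_linear[OF assms(1)]] by simp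
qed

lemma sphere_curve_orthogonal:
  fixes c :: "real \<Rightarrow> 'a::real_inner"
  assumes "\<And>s. norm (c s) = 1" "(c has_vector_derivative v) (at t)"
  shows "v \<bullet> c t = 0"
proof -
  have "((\<lambda>s. c s \<bullet> c s) has_vector_derivative (c t \<bullet> v + v \<bullet> c t)) (at t)"
    by (rule bounded_bilinear.has_vector_derivative[OF bounded_bilinear_inner assms(2) assms(2)])
  moreover have "(\<lambda>s. c s \<bullet> c s) = (\<lambda>s. 1)" using assms(1) by (simp add: norm_eq_1)
  ultimately have "((\<lambda>s. 1 :: real) has_vector_derivative (c t \<bullet> v + v \<bullet> c t)) (at t)" by simp
  then have "c t \<bullet> v + v \<bullet> c t = 0"
    using vector_derivative_unique_at has_vector_derivative_const by blast
  then show ?thesis by (simp add: inner_commute)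
qed

text \<open>The acceleration is minus the position, so rotating position and velocity back by the
  angle \<open>t\<close> yields two constant vectors.\<close>

lemma unit_speed_geodesic_great_circle:
  fixes \<gamma> :: "real \<Rightarrow> 'a::euclidean_space"
  assumes "unit_speed_geodesic \<gamma>"
  obtains p q where "norm p = 1" "norm q = 1" "p \<bullet> q = 0"
    "\<And>t. \<gamma> t = cos t *\<^sub>R p + sin t *\<^sub>R q"
proof -
  define v where "v t = vector_derivative \<gamma> (at t)" for t
  have n\<gamma>: "norm (\<gamma> t) = 1" and nv: "norm (v t) = 1"
    and d\<gamma>: "(\<gamma> has_vector_derivative v t) (at t)" for t
    using assms by (auto simp: unit_speed_geodesic_def v_def vector_derivative_works)
  have orth: "v t \<bullet> \<gamma> t = 0" for t by (rule sphere_curve_orthogonal[OF n\<gamma> d\<gamma>])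
  have dv: "(v has_vector_derivative - \<gamma> t) (at t)" for t
  proof -
    obtain a where a: "(v has_vector_derivative a) (at t)" "tan_proj (\<gamma> t) a = 0"
      using assms unfolding unit_speed_geodesic_def v_def by blast
    \<comment> \<open>Differentiating the orthogonality of velocity and position determines the
      radial component of the acceleration.\<close>
    have "((\<lambda>s. v s \<bullet> \<gamma> s) has_vector_derivative (v t \<bullet> v t + a \<bullet> \<gamma> t)) (at t)"
      by (rule bounded_bilinear.has_vector_derivative[OF bounded_bilinear_inner a(1) d\<gamma>])
    then have "((\<lambda>s. 0 :: real) has_vector_derivative (v t \<bullet> v t + a \<bullet> \<gamma> t)) (at t)"
      by (simp add: orth)
    then have "v t \<bullet> v t + a \<bullet> \<gamma> t = 0"
      using vector_derivative_unique_at has_vector_derivative_const by blast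
    moreover have "v t \<bullet> v t = 1" using nv by (simp add: norm_eq_1)
    ultimately have "a \<bullet> \<gamma> t = - 1" by linarith
    then have "a = - \<gamma> t" using a(2) by (simp add: tan_proj_def add_eq_0_iff2)
    then show ?thesis using a(1) by simp
  qed
  have "((\<lambda>t. cos t *\<^sub>R \<gamma> t - sin t *\<^sub>R v t) has_vector_derivative
      (cos t *\<^sub>R v t + - sin t *\<^sub>R \<gamma> t) - (sin t *\<^sub>R - \<gamma> t + cos t *\<^sub>R v t)) (at t)" for t
    by (intro has_vector_derivative_diff has_vector_derivative_scaleR d\<gamma> dv DERIV_cos DERIV_sin)
  then have 0: "((\<lambda>t. cos t *\<^sub>R \<gamma> t - sin t *\<^sub>R v t) has_vector_derivative 0) (at t within UNIV)" for t
    by simp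
  obtain p where p: "\<And>t. cos t *\<^sub>R \<gamma> t - sin t *\<^sub>R v t = p"
    by (rule has_vector_derivative_zero_constant[OF convex_UNIV 0]) auto
  have "((\<lambda>t. sin t *\<^sub>R \<gamma> t + cos t *\<^sub>R v t) has_vector_derivative
      (sin t *\<^sub>R v t + cos t *\<^sub>R \<gamma> t) + (cos t *\<^sub>R - \<gamma> t + - sin t *\<^sub>R v t)) (at t)" for t
    by (intro has_vector_derivative_add has_vector_derivative_scaleR d\<gamma> dv DERIV_cos DERIV_sin)
  then have 0: "((\<lambda>t. sin t *\<^sub>R \<gamma> t + cos t *\<^sub>R v t) has_vector_derivative 0) (at t within UNIV)" for t
    by simp
  obtain q where q: "\<And>t. sin t *\<^sub>R \<gamma> t + cos t *\<^sub>R v t = q"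
    by (rule has_vector_derivative_zero_constant[OF convex_UNIV 0]) auto
  have p0: "p = \<gamma> 0" "q = v 0" using p[of 0] q[of 0] by auto
  have "\<gamma> t = cos t *\<^sub>R p + sin t *\<^sub>R q" for t
  proof -
    have "cos t *\<^sub>R p + sin t *\<^sub>R q = (cos t * cos t + sin t * sin t) *\<^sub>R \<gamma> t"
      unfolding p[of t, symmetric] q[of t, symmetric]
      by (simp add: algebra_simps del: sin_cos_squared_add3)
    then show ?thesis by simp
  qed
  moreover have "norm p = 1" "norm q = 1" "p \<bullet> q = 0"
    using n\<gamma> nv orth[of 0] by (simp_all add: p0 inner_commute)
  ultimately show ?thesis using that by blast
qed

text \<open>The derivative at \<open>U y\<close> is the conjugate by \<open>U\<close> of the
  derivative at \<open>y\<close>, and the trace may be computed in the image of the standard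
  basis.\<close>

lemma divergence_orthogonal_invariant:
  assumes f: "twice_differentiable_on (- {0}) f" and y: "y \<noteq> 0" and U: "orthogonal_transformation U"
    and eq: "\<And>z. z \<noteq> 0 \<Longrightarrow> f (U z) = U (f z)"
  shows "divergence f (U y) = divergence f y"
proof -
  have lin: "linear U" using U by (simp add: orthogonal_transformation_def)
  have inn: "U v \<bullet> U w = v \<bullet> w" for v w using U by (simp add: orthogonal_transformation_def)
  have inj: "inj U" using U by (rule orthogonal_transformation_inj)
  have Uy: "U y \<noteq> 0" using inj y lin by (metis injD linear_0)
  have D: "frechet_derivative f (at (U y)) (U w) = U (frechet_derivative f (at y) w)" for w
    using y Uy by (intro frechet_derivative_equivariant[OF f _ _ lin lin]) (auto simp: eq)
  have oB: "pairwise orthogonal (U ` Basis)"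
    by (auto simp: pairwise_image pairwise_def orthogonal_def inn inner_Basis)
  have nB: "norm e = 1" if "e \<in> U ` Basis" for e
    using that by (auto simp: norm_eq_1 inn inner_Basis)
  have "card (U ` Basis) = DIM('a)"
    using inj by (metis card_image inj_on_subset subset_UNIV)
  from trace_of_orthonormal[OF oB nB span_orthonormal_card[OF oB nB this]
      linear_frechet_derivative_at[OF f], of "U y"] Uy
  have "divergence f (U y) = (\<Sum>e\<in>U ` Basis. frechet_derivative f (at (U y)) e \<bullet> e)"
    by (simp add: divergence_def)
  also have "\<dots> = (\<Sum>b\<in>Basis. frechet_derivative f (at (U y)) (U b) \<bullet> U b)"
    using inj by (subst sum.reindex) (auto intro: inj_on_subset)
  also have "\<dots> = divergence f y" by (simp add: D inn divergence_def trace_of_def)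
  finally show ?thesis .
qed

lemma divergence_homogeneous_ext_scale:
  assumes \<phi>: "smooth_sphere_map \<phi>" and y: "y \<noteq> 0" and c: "c > 0"
  shows "divergence (homogeneous_ext r \<phi>) (c *\<^sub>R y) = c powi (r - 1) * divergence (homogeneous_ext r \<phi>) y"
  by (simp add: divergence_def trace_of_def sum_distrib_left
      frechet_derivative_homogeneous_ext_scale[OF assms])

section \<open>The k-map along a normal geodesic\<close>

text \<open>Carries identities from the principal parameters to the two singular ends of the orbit
  space.\<close>

lemma continuous_eq_const_closed_interval:
  fixes f :: "real \<Rightarrow> real"
  assumes "a < b" "continuous_on {a..b} f" "\<And>t. a < t \<Longrightarrow> t < b \<Longrightarrow> f t = c" "t \<in> {a..b}"
  shows "f t = c"
  using continuous_constant_on_closure[of "{a<..<b}" f c t] assms by simp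

locale k_map_action =
  fixes G :: "'g monoid" and T :: "'g topology"
    and A :: "('g set \<times> ('g \<Rightarrow> 'e::euclidean_space)) set"
    and act :: "'g \<Rightarrow> 'a::euclidean_space \<Rightarrow> 'a"
    and \<gamma> :: "real \<Rightarrow> 'a" and \<phi> :: "'a \<Rightarrow> 'a"
    and g m0 m1 n :: nat and k :: int
  assumes dimension: "DIM('a) = n + 2" and n_eq: "real n = (real m0 + real m1) / 2 * real g"
    and gmm: "gmm_action G T A act g m0 m1"
    and normal: "normal_geodesic G act \<gamma>" and orbit_data: "orbit_space_data G act \<gamma> g m0 m1"
    and k_map: "is_k_map G act \<gamma> k \<phi>"
begin

abbreviation "\<Psi> \<equiv> homogeneous_ext (- k) \<phi>"
abbreviation "D\<Psi> y \<equiv> frechet_derivative (homogeneous_ext (- k) \<phi>) (at y)"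

lemma g_pos: "g > 0" and odd_g: "odd g \<Longrightarrow> m0 = m1"
  using gmm by (auto simp: gmm_action_def)

lemma smooth: "smooth_sphere_map \<phi>"
  using k_map by (simp add: is_k_map_def)

lemma group_action: "group_action G (sphere 0 1) act"
  using gmm by (auto simp: gmm_action_def isometric_sphere_action_def)

lemma group: "group G"
  using gmm by (auto simp: gmm_action_def compact_lie_group_def)

lemma norm_act: "a \<in> carrier G \<Longrightarrow> norm x = 1 \<Longrightarrow> norm (act a x) = 1"
  using group_action.element_image[OF group_action, of a x] by simp

lemma act_one: "norm x = 1 \<Longrightarrow> act \<one>\<^bsub>G\<^esub> x = x"
  using fun_cong[OF group_action.id_eq_one[OF group_action], of x] by simp

lemma act_mult:
  "a \<in> carrier G \<Longrightarrow> b \<in> carrier G \<Longrightarrow> norm x = 1 \<Longrightarrow> act (a \<otimes>\<^bsub>G\<^esub> b) x = act a (act b x)"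
  using group_action.composition_rule[OF group_action, of x a b] by simp

section \<open>The linearized action and the frame along the geodesic\<close>

text \<open>The action is given on the sphere only, where an isometry extends to an orthogonal map;
  the chain rule for \<open>\<Psi>\<close> requires a map of the whole space.\<close>

definition lin_act :: "'g \<Rightarrow> 'a \<Rightarrow> 'a" where
  "lin_act a = (SOME U. orthogonal_transformation U \<and> (\<forall>x. norm x = 1 \<longrightarrow> U x = act a x))"

lemma lin_act:
  assumes a: "a \<in> carrier G"
  shows "orthogonal_transformation (lin_act a)" "norm x = 1 \<Longrightarrow> lin_act a x = act a x"
proof -
  have "\<exists>U. orthogonal_transformation U \<and> (\<forall>x. norm x = 1 \<longrightarrow> U x = act a x)"
  proof (rule isometry_sphere_extend)
    show "norm (act a x) = 1" if "norm x = 1" for x using norm_act[OF a that] .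
    show "dist (act a x) (act a y) = dist x y" if "norm x = 1" "norm y = 1" for x y
      using gmm a that by (simp add: gmm_action_def isometric_sphere_action_def)
  qed
  from someI_ex[OF this] show "orthogonal_transformation (lin_act a)" "norm x = 1 \<Longrightarrow> lin_act a x = act a x"
    by (auto simp: lin_act_def)
qed

lemma gamma_great_circle:
  "\<gamma> t = cos t *\<^sub>R \<gamma> 0 + sin t *\<^sub>R \<gamma> (pi / 2)"
  "norm (\<gamma> 0) = 1" "norm (\<gamma> (pi / 2)) = 1" "\<gamma> 0 \<bullet> \<gamma> (pi / 2) = 0"
proof -
  have "unit_speed_geodesic \<gamma>" using normal by (simp add: normal_geodesic_def)
  then obtain p q where pq: "norm p = 1" "norm q = 1" "p \<bullet> q = 0"
    and \<gamma>: "\<And>t. \<gamma> t = cos t *\<^sub>R p + sin t *\<^sub>R q"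
    by (rule unit_speed_geodesic_great_circle) blast
  have "\<gamma> 0 = p" "\<gamma> (pi / 2) = q" by (simp_all add: \<gamma>)
  then show "\<gamma> t = cos t *\<^sub>R \<gamma> 0 + sin t *\<^sub>R \<gamma> (pi / 2)"
    "norm (\<gamma> 0) = 1" "norm (\<gamma> (pi / 2)) = 1" "\<gamma> 0 \<bullet> \<gamma> (pi / 2) = 0"
    using pq \<gamma> by simp_all
qed

lemma gamma_inner: "\<gamma> s \<bullet> \<gamma> t = cos (s - t)"
  using gamma_great_circle(2-4)
  by (subst (1 2) gamma_great_circle(1))
    (simp add: inner_add_left inner_add_right cos_diff norm_eq_1 inner_commute)

lemma norm_gamma: "norm (\<gamma> t) = 1" and gamma_nonzero: "\<gamma> t \<noteq> 0"
  using gamma_inner[of t t] by (auto simp: norm_eq_1)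

text \<open>On a great circle the velocity is the point a quarter turn ahead, so all inner products
  reduce to \<open>gamma_inner\<close>.\<close>

definition vel :: "real \<Rightarrow> 'a" where "vel t = \<gamma> (t + pi / 2)"

lemma vel_eq: "vel t = - sin t *\<^sub>R \<gamma> 0 + cos t *\<^sub>R \<gamma> (pi / 2)"
  using gamma_great_circle(1)[of "t + pi / 2"] by (simp add: vel_def cos_add sin_add)

lemma gamma_vel:
  "norm (vel t) = 1" "\<gamma> t \<bullet> vel t = 0" "\<gamma> s \<bullet> vel t = sin (s - t)" "vel s \<bullet> vel t = cos (s - t)"
  using norm_gamma by (simp_all add: vel_def gamma_inner cos_diff cos_add sin_add sin_diff)

lemma gamma_shift: "\<gamma> s = cos (s - t) *\<^sub>R \<gamma> t + sin (s - t) *\<^sub>R vel t"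
proof -
  have trig: "cos s = cos (s - t) * cos t - sin (s - t) * sin t"
    "sin s = cos (s - t) * sin t + sin (s - t) * cos t"
    using cos_add[of "s - t" t] sin_add[of "s - t" t] by simp_all
  show ?thesis
    unfolding vel_eq gamma_great_circle(1)[of s] gamma_great_circle(1)[of t] trig
    by (simp only: scaleR_add_right scaleR_diff_left scaleR_add_left scaleR_scaleR) simp
qed

lemma vel_shift: "vel s = - sin (s - t) *\<^sub>R \<gamma> t + cos (s - t) *\<^sub>R vel t"
  using gamma_shift[of "s + pi / 2" t] by (simp add: vel_def cos_add sin_add cos_diff sin_diff)

lemma gamma_has_vector_derivative: "(\<gamma> has_vector_derivative vel t) (at t)"
proof -
  have "((\<lambda>t. cos t *\<^sub>R \<gamma> 0 + sin t *\<^sub>R \<gamma> (pi / 2)) has_vector_derivative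
     (cos t *\<^sub>R 0 + - sin t *\<^sub>R \<gamma> 0) + (sin t *\<^sub>R 0 + cos t *\<^sub>R \<gamma> (pi / 2))) (at t)"
    by (intro has_vector_derivative_add has_vector_derivative_scaleR has_vector_derivative_const
        DERIV_cos DERIV_sin)
  moreover have "(\<lambda>t. cos t *\<^sub>R \<gamma> 0 + sin t *\<^sub>R \<gamma> (pi / 2)) = \<gamma>"
    by (rule ext) (rule gamma_great_circle(1)[symmetric])
  ultimately show ?thesis by (simp add: vel_eq)
qed

lemma continuous_gamma: "continuous_on S \<gamma>"
  using gamma_has_vector_derivative
  by (meson continuous_at_imp_continuous_on has_vector_derivative_continuous)

lemma orbit_representation:
  assumes "norm x = 1"
  obtains a t where "a \<in> carrier G" "0 \<le> t" "t \<le> pi / real g" "x = act a (\<gamma> t)"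
proof -
  have x: "x \<in> sphere 0 1" using assms by simp
  obtain t where t: "t \<in> {0..pi / real g}" "\<gamma> t \<in> orbit G act x"
    using orbit_data x unfolding orbit_space_data_def by blast
  have "x \<in> orbit G act (\<gamma> t)"
    using group_action.orbit_sym[OF group_action x _ t(2)] norm_gamma by simp
  then show ?thesis using that t by (auto simp: orbit_def)
qed

text \<open>Every point is \<open>act b (\<gamma> t)\<close> for some \<open>b\<close>, and the
  defining equation of the \<open>k\<close>-map applies to the product of \<open>a\<close> and
  \<open>b\<close>.\<close>

lemma phi_act:
  assumes a: "a \<in> carrier G" and x: "norm x = 1"
  shows "\<phi> (act a x) = act a (\<phi> x)"
proof -
  obtain b t where b: "b \<in> carrier G" "x = act b (\<gamma> t)" using orbit_representation[OF x] by metis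
  have k: "\<phi> (act c (\<gamma> t)) = act c (\<gamma> (of_int k * t))" if "c \<in> carrier G" for c
    using k_map that by (simp add: is_k_map_def)
  have "\<phi> (act a x) = \<phi> (act (a \<otimes>\<^bsub>G\<^esub> b) (\<gamma> t))" using a b norm_gamma by (simp add: act_mult)
  also have "\<dots> = act (a \<otimes>\<^bsub>G\<^esub> b) (\<gamma> (of_int k * t))"
    using a b group by (intro k) (simp add: group.is_monoid monoid.m_closed)
  also have "\<dots> = act a (\<phi> x)" using a b norm_gamma by (simp add: act_mult k)
  finally show ?thesis .
qed

lemma phi_gamma: "\<phi> (\<gamma> t) = \<gamma> (of_int k * t)"
proof -
  have "\<one>\<^bsub>G\<^esub> \<in> carrier G" using group by (simp add: group.is_monoid monoid.one_closed)
  then have "\<phi> (act \<one>\<^bsub>G\<^esub> (\<gamma> t)) = act \<one>\<^bsub>G\<^esub> (\<gamma> (of_int k * t))"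
    using k_map by (simp add: is_k_map_def)
  then show ?thesis by (simp add: act_one norm_gamma)
qed

lemma Psi_gamma: "\<Psi> (\<gamma> t) = \<gamma> (of_int k * t)"
  by (simp add: homogeneous_ext_unit norm_gamma phi_gamma)

lemma Psi_lin_act:
  assumes a: "a \<in> carrier G" and y: "y \<noteq> 0"
  shows "\<Psi> (lin_act a y) = lin_act a (\<Psi> y)"
proof -
  have U: "linear (lin_act a)" "norm (lin_act a z) = norm z" for z
    using lin_act(1)[OF a] by (auto simp: orthogonal_transformation)
  have u: "norm (y /\<^sub>R norm y) = 1" using y by simp
  have "lin_act a y /\<^sub>R norm (lin_act a y) = act a (y /\<^sub>R norm y)"
    using lin_act(2)[OF a u] by (simp add: U linear_scale)
  then have "\<phi> (lin_act a y /\<^sub>R norm (lin_act a y)) = lin_act a (\<phi> (y /\<^sub>R norm y))"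
    using phi_act[OF a u] lin_act(2)[OF a smooth_sphere_map_norm[OF smooth u]] by simp
  then show ?thesis by (simp add: homogeneous_ext_def U linear_scale)
qed

lemmas Psi_twice = twice_differentiable_on_homogeneous_ext[OF smooth, of "- k"]

lemma D_Psi: "y \<noteq> 0 \<Longrightarrow> (\<Psi> has_derivative D\<Psi> y) (at y)"
  using twice_differentiable_onD(2)[OF Psi_twice] by simp

lemma linear_D_Psi: "y \<noteq> 0 \<Longrightarrow> linear (D\<Psi> y)"
  using linear_frechet_derivative_at[OF Psi_twice] by simp

text \<open>Curves in an orbit stay on the sphere, their velocities are orthogonal to the normal
  geodesic, and an invariant function is constant along them.\<close>

lemma orbit_tangent:
  assumes w: "w \<in> tangent_space (orbit G act (\<gamma> t)) (\<gamma> t)"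
  shows "w \<bullet> \<gamma> t = 0" "w \<bullet> vel t = 0"
    and "(f has_derivative f') (at (\<gamma> t)) \<Longrightarrow> (\<And>a. a \<in> carrier G \<Longrightarrow> f (act a (\<gamma> t)) = f (\<gamma> t)) \<Longrightarrow>
      f' w = (0 :: real)"
proof -
  obtain c where c: "\<And>s :: real. c s \<in> orbit G act (\<gamma> t)" "c 0 = \<gamma> t" "(c has_vector_derivative w) (at 0)"
    using w unfolding tangent_space_def by blast
  have rep: "\<exists>a\<in>carrier G. c s = act a (\<gamma> t)" for s using c(1)[of s] by (auto simp: orbit_def)
  have norm_c: "norm (c s) = 1" for s
  proof -
    obtain a where "a \<in> carrier G" "c s = act a (\<gamma> t)" using rep by blast
    then show ?thesis by (simp add: norm_act norm_gamma)
  qed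
  from sphere_curve_orthogonal[OF norm_c c(3)] show "w \<bullet> \<gamma> t = 0" by (simp add: c(2))
  have "vector_derivative \<gamma> (at t) \<bullet> w = 0" using normal w by (simp add: normal_geodesic_def)
  then show "w \<bullet> vel t = 0"
    using vector_derivative_at[OF gamma_has_vector_derivative] by (simp add: inner_commute)
  show "f' w = 0" if f: "(f has_derivative f') (at (\<gamma> t))"
    and inv: "\<And>a. a \<in> carrier G \<Longrightarrow> f (act a (\<gamma> t)) = f (\<gamma> t)"
  proof -
    have "((\<lambda>s. f (c s)) has_vector_derivative f' w) (at 0)"
      by (rule has_vector_derivative_along[where c = c, OF _ c(3)]) (simp add: c(2) f)
    moreover have "f (c s) = f (\<gamma> t)" for s
    proof -
      obtain a where "a \<in> carrier G" "c s = act a (\<gamma> t)" using rep by blast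
      then show ?thesis using inv by simp
    qed
    ultimately have "((\<lambda>s. f (\<gamma> t)) has_vector_derivative f' w) (at (0::real))" by simp
    then show "f' w = 0"
      by (rule vector_derivative_unique_at) (rule has_vector_derivative_const)
  qed
qed

lemma principal:
  assumes "0 < t" "t < pi / real g"
  shows "principal_point G act (\<gamma> t)"
proof (rule ccontr)
  assume "\<not> principal_point G act (\<gamma> t)"
  then obtain i :: int where i: "t = of_int i * pi / real g"
    using orbit_data unfolding orbit_space_data_def by blast
  have "0 < of_int i * pi" "of_int i * pi < pi"
    using assms g_pos unfolding i by (simp_all add: field_simps)
  then have "(0::real) < of_int i" "of_int i < (1::real)" by (simp_all add: zero_less_mult_iff)
  then show False by simp
qed

lemma orbit_tangent_spans:
  assumes "0 < t" "t < pi / real g"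
  shows "span (insert (\<gamma> t) (insert (vel t) (tangent_space (orbit G act (\<gamma> t)) (\<gamma> t)))) = UNIV"
  using gmm principal[OF assms] norm_gamma gamma_vel orbit_tangent
  by (intro span_insert2_eq_UNIV) (auto simp: gmm_action_def)

text \<open>Each principal curvature has a nonzero eigenvector. For \<open>g = 1\<close> there is no
  curvature of index \<open>1\<close>, and \<open>m1 = m0\<close> because \<open>g\<close> is
  odd.\<close>

lemma m_pos: "m0 > 0" "m1 > 0"
proof -
  define t where "t = pi / (2 * real g)"
  have t: "0 < t" "t < pi / real g" using g_pos by (simp_all add: t_def field_simps)
  let ?M = "orbit G act (\<gamma> t)"
  have "has_principal_curvature_data ?M g m0 m1"
    using gmm principal[OF t] by (simp add: gmm_action_def)
  moreover have "\<gamma> t \<in> ?M" using group_action.orbit_refl[OF group_action] norm_gamma by simp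
  ultimately obtain \<nu> l where l: "principal_curvatures ?M \<nu> (\<gamma> t) = l ` {..<g}"
    "\<And>i. i < g \<Longrightarrow> dim (curvature_eigenspace ?M \<nu> (\<gamma> t) (l i)) = parity_mult m0 m1 i"
    unfolding has_principal_curvature_data_def by metis
  have pos: "parity_mult m0 m1 i > 0" if i: "i < g" for i
  proof -
    have "l i \<in> principal_curvatures ?M \<nu> (\<gamma> t)" using l(1) i by blast
    then obtain v where "v \<in> curvature_eigenspace ?M \<nu> (\<gamma> t) (l i)" "v \<noteq> 0"
      by (auto simp: principal_curvatures_def)
    then have "dim (curvature_eigenspace ?M \<nu> (\<gamma> t) (l i)) \<noteq> 0" by (auto simp: dim_eq_0)
    then show ?thesis using l(2)[OF i] by simp
  qed
  show m0: "m0 > 0" using pos[of 0] g_pos by (simp add: parity_mult_def)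
  show "m1 > 0"
  proof (cases "g = 1")
    case True
    then show ?thesis using odd_g m0 by simp
  next
    case False
    then show ?thesis using pos[of 1] g_pos by (simp add: parity_mult_def)
  qed
qed

section \<open>The extension as a gradient field\<close>

text \<open>A potential of \<open>\<Psi>\<close> up to the factor \<open>1 - k\<close>. It is
  invariant under the action and equals \<open>cos ((k - 1) * t)\<close> at
  \<open>\<gamma> t\<close>.\<close>

definition pot :: "'a \<Rightarrow> real" where "pot y = \<Psi> y \<bullet> y"

lemma D_pot: "y \<noteq> 0 \<Longrightarrow> (pot has_derivative (\<lambda>w. \<Psi> y \<bullet> w + D\<Psi> y w \<bullet> y)) (at y)"
  unfolding pot_def[abs_def] by (intro has_derivative_inner D_Psi has_derivative_ident)

lemma inner_lin_act: "a \<in> carrier G \<Longrightarrow> lin_act a v \<bullet> lin_act a w = v \<bullet> w"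
  using lin_act(1) by (simp add: orthogonal_transformation_def)

text \<open>Both sides are linear in \<open>w\<close>. Euler's relation settles the position, the
  explicit form of \<open>pot\<close> along \<open>\<gamma>\<close> the velocity, and on orbit
  directions both sides vanish.\<close>

lemma grad_pot_principal:
  assumes t: "0 < t" "t < pi / real g"
  shows "\<Psi> (\<gamma> t) \<bullet> w + D\<Psi> (\<gamma> t) w \<bullet> \<gamma> t = of_int (1 - k) * (\<Psi> (\<gamma> t) \<bullet> w)"
proof -
  let ?L = "\<lambda>w. \<Psi> (\<gamma> t) \<bullet> w + D\<Psi> (\<gamma> t) w \<bullet> \<gamma> t"
  let ?R = "\<lambda>w. of_int (1 - k) * (\<Psi> (\<gamma> t) \<bullet> w)"
  have linL: "linear ?L" using D_pot[OF gamma_nonzero] by (rule has_derivative_linear)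
  have linR: "linear ?R" by (auto intro!: linearI simp: inner_add_right algebra_simps)
  have "?L w = ?R w" if "w \<in> insert (\<gamma> t) (insert (vel t) (tangent_space (orbit G act (\<gamma> t)) (\<gamma> t)))" for w
    using that
  proof (elim insertE)
    assume "w = \<gamma> t"
    then show ?thesis
      using homogeneous_ext_euler(1)[OF smooth gamma_nonzero, of "- k" t] by (simp add: algebra_simps)
  next
    assume w: "w = vel t"
    have "((\<lambda>s. pot (\<gamma> s)) has_vector_derivative ?L (vel t)) (at t)"
      by (rule has_vector_derivative_along[OF D_pot[OF gamma_nonzero] gamma_has_vector_derivative])
    moreover have "(\<lambda>s. pot (\<gamma> s)) = (\<lambda>s. cos (of_int (k - 1) * s))"
      by (simp add: pot_def Psi_gamma gamma_inner left_diff_distrib)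
    moreover have "((\<lambda>s. cos (of_int (k - 1) * s)) has_vector_derivative
        - sin (of_int (k - 1) * t) * of_int (k - 1)) (at t)"
      unfolding has_real_derivative_iff_has_vector_derivative[symmetric]
      by (auto intro!: derivative_eq_intros)
    ultimately have "?L (vel t) = - sin (of_int (k - 1) * t) * of_int (k - 1)"
      using vector_derivative_unique_at by metis
    also have "\<dots> = ?R (vel t)"
      by (simp add: Psi_gamma gamma_vel left_diff_distrib[of _ _ t]) (simp add: algebra_simps)
    finally show ?thesis using w by simp
  next
    assume w: "w \<in> tangent_space (orbit G act (\<gamma> t)) (\<gamma> t)"
    have "pot (act a (\<gamma> t)) = pot (\<gamma> t)" if a: "a \<in> carrier G" for a
      by (simp only: pot_def lin_act(2)[OF a norm_gamma, symmetric] Psi_lin_act[OF a gamma_nonzero]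
          inner_lin_act[OF a])
    then have "?L w = 0" using orbit_tangent(3)[OF w D_pot[OF gamma_nonzero]] by blast
    \<comment> \<open>The value \<open>\<Psi> (\<gamma> t)\<close> lies in the plane of the
      geodesic, to which orbit directions are orthogonal.\<close>
    moreover have "\<gamma> t \<bullet> w = 0" "vel t \<bullet> w = 0"
      using orbit_tangent(1,2)[OF w] by (simp_all only: inner_commute[of w])
    then have "\<gamma> (of_int k * t) \<bullet> w = 0"
      unfolding gamma_shift[of "of_int k * t" t] by (simp add: inner_add_left)
    ultimately show ?thesis by (simp add: Psi_gamma)
  qed
  from linear_eq_on_span[OF linL linR this] show ?thesis
    using orbit_tangent_spans[OF t] by (metis UNIV_I)
qed

lemma continuous_D_Psi: "continuous_on (- {0}) (\<lambda>y. D\<Psi> y w)"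
  using twice_differentiable_onD(3)[OF Psi_twice]
  by (meson continuous_at_imp_continuous_on has_derivative_continuous)

lemma continuous_Psi: "continuous_on (- {0}) \<Psi>"
  using twice_differentiable_onD(2)[OF Psi_twice]
  by (meson continuous_at_imp_continuous_on has_derivative_continuous)

text \<open>The identity spreads from the principal parameters to the closed interval by continuity,
  to the sphere by equivariance, and to all \<open>y \<noteq> 0\<close> by homogeneity.\<close>

lemma grad_pot:
  assumes y: "y \<noteq> 0"
  shows "\<Psi> y \<bullet> w + D\<Psi> y w \<bullet> y = of_int (1 - k) * (\<Psi> y \<bullet> w)"
proof -
  have closed: "\<Psi> (\<gamma> t) \<bullet> w + D\<Psi> (\<gamma> t) w \<bullet> \<gamma> t = of_int (1 - k) * (\<Psi> (\<gamma> t) \<bullet> w)"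
    if t: "t \<in> {0..pi / real g}" for t w
  proof -
    have "continuous_on {0..pi / real g} (\<lambda>t. \<Psi> (\<gamma> t))"
      "continuous_on {0..pi / real g} (\<lambda>t. D\<Psi> (\<gamma> t) w)"
      using gamma_nonzero
      by (auto intro!: continuous_on_compose2[OF continuous_Psi continuous_gamma]
          continuous_on_compose2[OF continuous_D_Psi continuous_gamma])
    then have "continuous_on {0..pi / real g}
        (\<lambda>t. \<Psi> (\<gamma> t) \<bullet> w + D\<Psi> (\<gamma> t) w \<bullet> \<gamma> t - of_int (1 - k) * (\<Psi> (\<gamma> t) \<bullet> w))"
      by (intro continuous_intros continuous_gamma)
    from continuous_eq_const_closed_interval[OF _ this, of 0 t] show ?thesis
      using grad_pot_principal g_pos t by simp
  qed
  have sphere: "\<Psi> x \<bullet> w + D\<Psi> x w \<bullet> x = of_int (1 - k) * (\<Psi> x \<bullet> w)" if x: "norm x = 1" for x w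
  proof -
    obtain a t where a: "a \<in> carrier G" and t: "t \<in> {0..pi / real g}" and xa: "x = act a (\<gamma> t)"
      using orbit_representation[OF x] by (metis atLeastAtMost_iff)
    have x': "x = lin_act a (\<gamma> t)" unfolding xa by (rule lin_act(2)[OF a norm_gamma, symmetric])
    have x0: "lin_act a (\<gamma> t) \<noteq> 0" using x unfolding x' by auto
    have lin: "linear (lin_act a)" and surj: "surj (lin_act a)"
      using lin_act(1)[OF a] orthogonal_transformation_surj by (auto simp: orthogonal_transformation)
    obtain v where v: "w = lin_act a v" using surj by (metis surjD)
    have "D\<Psi> (lin_act a (\<gamma> t)) (lin_act a v) = lin_act a (D\<Psi> (\<gamma> t) v)"
      by (rule frechet_derivative_equivariant[OF Psi_twice _ _ lin lin])
        (simp_all add: gamma_nonzero x0 Psi_lin_act[OF a])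
    then show ?thesis
      using closed[OF t, of v] unfolding x' v Psi_lin_act[OF a gamma_nonzero] by (simp only: inner_lin_act[OF a])
  qed
  define c where "c = norm y"
  define x where "x = y /\<^sub>R norm y"
  have c: "c > 0" and x: "norm x = 1" and yc: "y = c *\<^sub>R x" using y by (simp_all add: c_def x_def)
  have x0: "x \<noteq> 0" using x by auto
  have "D\<Psi> (c *\<^sub>R x) (c *\<^sub>R w) = c powi (- k) *\<^sub>R D\<Psi> x w"
    using c x0 homogeneous_ext_scale[OF c]
    by (intro frechet_derivative_equivariant[OF Psi_twice]) (auto intro!: linearI simp: algebra_simps)
  then have "D\<Psi> (c *\<^sub>R x) w \<bullet> (c *\<^sub>R x) = c powi (- k) * (D\<Psi> x w \<bullet> x)"
    using linear_scale[OF linear_D_Psi, of "c *\<^sub>R x" c w] c x0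
    by (simp only: inner_scaleR_left[symmetric] inner_scaleR_right scaleR_eq_0_iff)
      (simp add: inner_scaleR_left[symmetric] del: inner_scaleR_left)
  then have "\<Psi> y \<bullet> w + D\<Psi> y w \<bullet> y = c powi (- k) * (\<Psi> x \<bullet> w + D\<Psi> x w \<bullet> x)"
    unfolding yc homogeneous_ext_scale[OF c] by (simp add: distrib_left)
  then show ?thesis
    unfolding sphere[OF x] by (simp add: yc homogeneous_ext_scale[OF c])
qed

text \<open>The left side is, up to the factor \<open>1 - k \<noteq> 0\<close>, a second derivative
  of \<open>pot\<close>.\<close>

lemma D_Psi_symmetric:
  assumes "k \<noteq> 1" "y \<noteq> 0"
  shows "D\<Psi> y v \<bullet> w = D\<Psi> y w \<bullet> v"
proof -
  have "(pot has_derivative (\<lambda>w. of_int (1 - k) * (\<Psi> z \<bullet> w))) (at z)" if "z \<in> - {0}" for z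
    using D_pot[of z] grad_pot[of z] that by simp
  moreover have "((\<lambda>z. of_int (1 - k) * (\<Psi> z \<bullet> w)) has_derivative (\<lambda>u. of_int (1 - k) * (D\<Psi> y u \<bullet> w))) (at y)" for w
    by (intro has_derivative_mult_right has_derivative_inner_left D_Psi assms)
  ultimately have "of_int (1 - k) * (D\<Psi> y v \<bullet> w) = of_int (1 - k) * (D\<Psi> y w \<bullet> v)"
    using symmetric_second_derivative_real[of "- {0}" y pot "\<lambda>z w. of_int (1 - k) * (\<Psi> z \<bullet> w)" w
        "\<lambda>u. of_int (1 - k) * (D\<Psi> y u \<bullet> w)" v "\<lambda>u. of_int (1 - k) * (D\<Psi> y u \<bullet> v)"] assms(2)
    by (simp add: open_Compl)
  then show ?thesis using assms(1) by simp
qed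

section \<open>Eigenspaces from isotropy groups\<close>

text \<open>The isotropy group of \<open>\<gamma> \<theta>\<close> fixes that point and moves
  \<open>\<gamma> t\<close>. Since \<open>\<Psi> (\<gamma> t)\<close> is a combination of the two
  points, equivariance makes \<open>\<Psi>\<close> affine along the isotropy orbit, with the
  eigenvalue as its linear part.\<close>

lemma isotropy_tangent:
  assumes w: "w \<in> tangent_space ((\<lambda>a. act a (\<gamma> t)) ` stabilizer G act (\<gamma> \<theta>)) (\<gamma> t)"
  shows "w \<in> tangent_space (orbit G act (\<gamma> t)) (\<gamma> t)"
    and "sin (t - \<theta>) \<noteq> 0 \<Longrightarrow> D\<Psi> (\<gamma> t) w = (sin (of_int k * t - \<theta>) / sin (t - \<theta>)) *\<^sub>R w"
proof -
  obtain c where c: "\<And>s :: real. c s \<in> (\<lambda>a. act a (\<gamma> t)) ` stabilizer G act (\<gamma> \<theta>)" "c 0 = \<gamma> t"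
    "(c has_vector_derivative w) (at 0)"
    using w unfolding tangent_space_def by blast
  have rep: "\<exists>a\<in>carrier G. c s = act a (\<gamma> t) \<and> act a (\<gamma> \<theta>) = \<gamma> \<theta>" for s
    using c(1)[of s] by (auto simp: stabilizer_def)
  have "c s \<in> orbit G act (\<gamma> t)" for s using rep[of s] unfolding orbit_def by blast
  then show "w \<in> tangent_space (orbit G act (\<gamma> t)) (\<gamma> t)"
    using c(2,3) unfolding tangent_space_def by blast
  assume nz: "sin (t - \<theta>) \<noteq> 0"
  \<comment> \<open>\<open>\<alpha>\<close> and \<open>\<delta>\<close> are the coordinates of
    \<open>\<gamma> (k * t)\<close> with respect to \<open>\<gamma> t\<close> and
    \<open>\<gamma> \<theta>\<close>, which are independent by \<open>nz\<close>.\<close>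
  define \<alpha> where "\<alpha> = sin (of_int k * t - \<theta>) / sin (t - \<theta>)"
  define \<delta> where "\<delta> = sin (t - of_int k * t) / sin (t - \<theta>)"
  have comb: "\<gamma> (of_int k * t) = \<alpha> *\<^sub>R \<gamma> t + \<delta> *\<^sub>R \<gamma> \<theta>"
  proof -
    let ?s = "of_int k * t"
    have "sin (t - \<theta>) * cos (?s - \<theta>) = sin (?s - \<theta>) * cos (t - \<theta>) + sin (t - ?s)"
      using sin_diff[of "t - \<theta>" "?s - \<theta>"] by (simp add: algebra_simps)
    then have "cos (?s - \<theta>) = \<alpha> * cos (t - \<theta>) + \<delta>"
      using nz by (simp add: \<alpha>_def \<delta>_def field_simps)
    moreover have "sin (?s - \<theta>) = \<alpha> * sin (t - \<theta>)" using nz by (simp add: \<alpha>_def)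
    ultimately show ?thesis
      unfolding gamma_shift[of ?s \<theta>] gamma_shift[of t \<theta>] by (simp add: algebra_simps)
  qed
  have "\<Psi> (c s) = \<alpha> *\<^sub>R c s + \<delta> *\<^sub>R \<gamma> \<theta>" for s
  proof -
    obtain a where a: "a \<in> carrier G" "c s = act a (\<gamma> t)" "act a (\<gamma> \<theta>) = \<gamma> \<theta>" using rep by blast
    have cs: "c s = lin_act a (\<gamma> t)" and inv: "lin_act a (\<gamma> \<theta>) = \<gamma> \<theta>"
      using a lin_act(2)[OF a(1) norm_gamma] by simp_all
    have lin: "linear (lin_act a)" using lin_act(1)[OF a(1)] by (simp add: orthogonal_transformation)
    show ?thesis
      unfolding cs Psi_lin_act[OF a(1) gamma_nonzero] Psi_gamma comb
      by (simp add: linear_add[OF lin] linear_scale[OF lin] inv)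
  qed
  moreover have "((\<lambda>s. \<Psi> (c s)) has_vector_derivative D\<Psi> (\<gamma> t) w) (at 0)"
    by (rule has_vector_derivative_along[where c = c, OF _ c(3)]) (simp add: c(2) D_Psi gamma_nonzero)
  ultimately have "((\<lambda>s. \<alpha> *\<^sub>R c s + \<delta> *\<^sub>R \<gamma> \<theta>) has_vector_derivative D\<Psi> (\<gamma> t) w) (at 0)" by simp
  moreover have "((\<lambda>s. \<alpha> *\<^sub>R c s + \<delta> *\<^sub>R \<gamma> \<theta>) has_vector_derivative \<alpha> *\<^sub>R w + 0) (at 0)"
    by (intro has_vector_derivative_add has_vector_derivative_const
        bounded_linear.has_vector_derivative[OF bounded_linear_scaleR_right c(3)])
  ultimately have "D\<Psi> (\<gamma> t) w = \<alpha> *\<^sub>R w" using vector_derivative_unique_at by fastforce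
  then show "D\<Psi> (\<gamma> t) w = (sin (of_int k * t - \<theta>) / sin (t - \<theta>)) *\<^sub>R w" by (simp add: \<alpha>_def)
qed

lemma D_Psi_vel: "D\<Psi> (\<gamma> t) (vel t) = of_int k *\<^sub>R vel (of_int k * t)"
proof -
  have "((\<lambda>s. \<Psi> (\<gamma> s)) has_vector_derivative D\<Psi> (\<gamma> t) (vel t)) (at t)"
    by (rule has_vector_derivative_along[OF D_Psi[OF gamma_nonzero] gamma_has_vector_derivative])
  moreover have "((\<lambda>s. of_int k * s) has_vector_derivative of_int k) (at t)"
    unfolding has_real_derivative_iff_has_vector_derivative[symmetric]
    by (auto intro!: derivative_eq_intros)
  then have "((\<lambda>s. \<gamma> (of_int k * s)) has_vector_derivative of_int k *\<^sub>R vel (of_int k * t)) (at t)"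
    using vector_diff_chain_at[OF _ gamma_has_vector_derivative, of "\<lambda>s. of_int k * s"] by (simp add: o_def)
  ultimately show ?thesis unfolding Psi_gamma using vector_derivative_unique_at by blast
qed

text \<open>After cross-multiplication the difference is \<open>sin (t - s) * sin (b - a)\<close>,
  and distinct indices below \<open>g\<close> are not congruent modulo \<open>g\<close>.
  Distinctness of the eigenvalues yields orthogonal eigenspaces.\<close>

lemma sin_ratio_inj:
  assumes g: "i < g" "j < g" "i \<noteq> j"
    and nz: "sin (t - real i * pi / real g) \<noteq> 0" "sin (t - real j * pi / real g) \<noteq> 0" "sin (t - s) \<noteq> 0"
  shows "sin (s - real i * pi / real g) / sin (t - real i * pi / real g) \<noteq>
    sin (s - real j * pi / real g) / sin (t - real j * pi / real g)"
proof
  let ?a = "real i * pi / real g" and ?b = "real j * pi / real g"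
  assume "sin (s - ?a) / sin (t - ?a) = sin (s - ?b) / sin (t - ?b)"
  then have "sin (s - ?a) * sin (t - ?b) - sin (s - ?b) * sin (t - ?a) = 0"
    using nz by (simp add: field_simps)
  moreover have "sin (s - a) * sin (t - b) - sin (s - b) * sin (t - a) = sin (t - s) * sin (b - a)" for a b
    unfolding sin_diff by algebra
  ultimately have "sin (?b - ?a) = 0" using nz(3) by simp
  then have "sin (?a - ?b) = 0" using sin_minus[of "?b - ?a"] by simp
  then obtain l :: int where "?a - ?b = of_int l * pi" by (auto simp: sin_zero_iff_int2)
  then have "(real i - real j) * pi = real g * of_int l * pi" using g by (simp add: field_simps)
  then have "real i - real j = real g * of_int l" by (simp only: mult_right_cancel pi_neq_zero not_False_eq_True)
  then have "of_int (int i - int j) = (of_int (int g * l) :: real)" by simp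
  then have "int i - int j = int g * l" by linarith
  then have "int g dvd int i - int j" by simp
  then show False using g dvd_imp_le_int[of "int i - int j" "int g"] by linarith
qed

lemma sum_parity_nat: "(\<Sum>i<g. parity_mult m0 m1 i) = n"
proof -
  have "real (\<Sum>i<g. parity_mult m0 m1 i) = real g / 2 * (real m0 + real m1)"
    unfolding of_nat_sum using odd_g by (rule sum_parity_mult)
  then have "real (\<Sum>i<g. parity_mult m0 m1 i) = real n" using n_eq by (simp add: mult.commute)
  then show ?thesis by linarith
qed

text \<open>The isotropy groups at the singular points \<open>\<gamma> (i \<pi>/g)\<close> sweep out eigenspaces of \<open>D\<Psi>\<close>,
  which together with the plane of the geodesic exhaust the space.\<close>

lemma divergence_gamma:
  assumes k: "k \<noteq> 1" and t: "0 < t" "t < pi / real g" and s: "sin (of_int (1 - k) * t) \<noteq> 0"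
  shows "divergence \<Psi> (\<gamma> t) = div_profile g m0 m1 (of_int (1 - k)) t"
proof -
  define \<theta> where "\<theta> i = real i * pi / real g" for i :: nat
  define K where "K i = tangent_space ((\<lambda>a. act a (\<gamma> t)) ` stabilizer G act (\<gamma> (\<theta> i))) (\<gamma> t)" for i
  define \<alpha> where "\<alpha> i = sin (of_int k * t - \<theta> i) / sin (t - \<theta> i)" for i
  have gt: "0 < real g * t" "real g * t < pi" using t g_pos by (simp_all add: field_simps)
  then have sg: "sin (real g * t) \<noteq> 0" using sin_gt_zero by fastforce
  have nz: "sin (t - \<theta> i) \<noteq> 0" for i
    using sin_shift_nonzero[OF g_pos sg, of "int i"] by (simp add: \<theta>_def)
  have dimK: "dim (K i) = parity_mult m0 m1 i" for i
    using orbit_data t unfolding orbit_space_data_def K_def \<theta>_def by auto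
  have lin: "linear (D\<Psi> (\<gamma> t))" by (rule linear_D_Psi[OF gamma_nonzero])
  \<comment> \<open>\<open>K i\<close> is given only as a set of velocities; the eigenvalue equation
    passes to its span, which has the same dimension and is a subspace.\<close>
  have eig: "D\<Psi> (\<gamma> t) v = \<alpha> i *\<^sub>R v" if "v \<in> span (K i)" for v i
    using that
  proof (induction rule: span_induct_alt)
    case base
    then show ?case by (simp add: linear_0[OF lin])
  next
    case (step c x y)
    then show ?case
      using isotropy_tangent(2)[OF _ nz, of x i] by (simp add: K_def \<alpha>_def linear_add[OF lin]
          linear_scale[OF lin] algebra_simps)
  qed
  have orth: "v \<bullet> \<gamma> t = 0 \<and> v \<bullet> vel t = 0" if "v \<in> span (K i)" for v i
    using that
  proof (induction rule: span_induct_alt)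
    case base
    then show ?case by simp
  next
    case (step c x y)
    then show ?case
      using orbit_tangent(1,2)[OF isotropy_tangent(1), of x t "\<theta> i"] by (simp add: K_def inner_add_left)
  qed
  have ne: "\<alpha> i \<noteq> \<alpha> j" if "i < g" "j < g" "i \<noteq> j" for i j
    using sin_ratio_inj[OF that, of t "of_int k * t"] nz s by (simp add: \<alpha>_def \<theta>_def left_diff_distrib)
  \<comment> \<open>Eigenvectors of a symmetric map for distinct eigenvalues are orthogonal.\<close>
  have "v \<bullet> w = 0" if ij: "i < g" "j < g" "i \<noteq> j" and vw: "v \<in> span (K i)" "w \<in> span (K j)" for i j v w
  proof -
    have "\<alpha> i * (v \<bullet> w) = \<alpha> j * (v \<bullet> w)"
      using D_Psi_symmetric[OF k gamma_nonzero, of t v w] eig[OF vw(1)] eig[OF vw(2)]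
      by (simp add: inner_commute)
    then show ?thesis using ne[OF ij] by simp
  qed
  then have "trace_of (D\<Psi> (\<gamma> t)) = (\<Sum>i<g. real (dim (span (K i))) * \<alpha> i) +
      (D\<Psi> (\<gamma> t) (\<gamma> t) \<bullet> \<gamma> t + D\<Psi> (\<gamma> t) (vel t) \<bullet> vel t)"
    using eig orth norm_gamma gamma_vel sum_parity_nat dimension dimK
    by (intro trace_of_eigenspaces[OF lin, where V = "\<lambda>i. span (K i)"]) auto
  \<comment> \<open>A second benefit of the degree \<open>- k\<close>: the position contributes
    \<open>- k * cos ((k - 1) * t)\<close> and the velocity the opposite value.\<close>
  moreover have "D\<Psi> (\<gamma> t) (\<gamma> t) \<bullet> \<gamma> t + D\<Psi> (\<gamma> t) (vel t) \<bullet> vel t = 0"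
    unfolding D_Psi_vel homogeneous_ext_euler(1)[OF smooth gamma_nonzero]
    by (simp add: Psi_gamma gamma_inner gamma_vel)
  ultimately have "divergence \<Psi> (\<gamma> t) = (\<Sum>i<g. real (parity_mult m0 m1 i) * \<alpha> i)"
    by (simp add: divergence_def dimK)
  also have "\<dots> = (\<Sum>i<g. real (parity_mult m0 m1 i) *
      (sin ((1 - of_int (1 - k)) * t - real i * pi / real g) / sin (t - real i * pi / real g)))"
    by (simp add: \<alpha>_def \<theta>_def)
  also have "\<dots> = div_profile g m0 m1 (of_int (1 - k)) t"
    using odd_g g_pos sg by (rule sum_sin_ratio)
  finally show ?thesis .
qed

section \<open>Harmonicity as a condition on the divergence along the geodesic\<close>

abbreviation "Ddiv y \<equiv> frechet_derivative (divergence (homogeneous_ext (- k) \<phi>)) (at y)"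

lemma D_div: "y \<noteq> 0 \<Longrightarrow> (divergence \<Psi> has_derivative Ddiv y) (at y)"
  using has_derivative_divergence[OF Psi_twice] frechet_derivative_works differentiableI by blast

lemma divergence_lin_act:
  assumes "a \<in> carrier G" "y \<noteq> 0"
  shows "divergence \<Psi> (lin_act a y) = divergence \<Psi> y"
  using assms by (intro divergence_orthogonal_invariant[OF Psi_twice] lin_act Psi_lin_act)

lemma harmonic_iff:
  assumes "k \<noteq> 1"
  shows "harmonic \<phi> \<longleftrightarrow> (\<forall>x v. norm x = 1 \<and> \<phi> x \<bullet> v = 0 \<longrightarrow> Ddiv x v = 0)"
  by (rule harmonic_iff_grad_divergence[OF smooth]) (rule D_Psi_symmetric[OF assms])

text \<open>The criterion is tested on \<open>vel (k * t)\<close>, which is orthogonal to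
  \<open>\<phi> (\<gamma> t)\<close> and is decomposed into \<open>\<gamma> t\<close> and
  \<open>vel t\<close>.\<close>

lemma harmonic_imp_ode:
  assumes "k \<noteq> 1" "harmonic \<phi>"
  shows "(2 - of_int (1 - k)) * divergence \<Psi> (\<gamma> t) * sin (of_int (1 - k) * t) =
    Ddiv (\<gamma> t) (vel t) * cos (of_int (1 - k) * t)"
proof -
  \<comment> \<open>The divergence is homogeneous of degree \<open>- k - 1\<close>, which is
    \<open>d - 2\<close> for \<open>d = 1 - k\<close>; this is the source of the factor
    \<open>2 - d\<close>.\<close>
  have e: "Ddiv (\<gamma> t) (\<gamma> t) = of_int (- k - 1) *\<^sub>R divergence \<Psi> (\<gamma> t)"
    using divergence_homogeneous_ext_scale[OF smooth gamma_nonzero, of _ "- k" t]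
    by (intro euler_homogeneous[OF D_div[OF gamma_nonzero]]) simp
  have lin: "linear (Ddiv (\<gamma> t))" by (rule has_derivative_linear[OF D_div[OF gamma_nonzero]])
  have "Ddiv (\<gamma> t) (vel (of_int k * t)) = 0"
    using assms harmonic_iff norm_gamma phi_gamma gamma_vel(2) by simp
  moreover have "of_int k * t - t = - (of_int (1 - k) * t)" by (simp add: algebra_simps)
  then have v: "vel (of_int k * t) = sin (of_int (1 - k) * t) *\<^sub>R \<gamma> t + cos (of_int (1 - k) * t) *\<^sub>R vel t"
    using vel_shift[of "of_int k * t" t] by simp
  ultimately have "sin (of_int (1 - k) * t) * (of_int (- k - 1) * divergence \<Psi> (\<gamma> t)) +
      cos (of_int (1 - k) * t) * Ddiv (\<gamma> t) (vel t) = 0"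
    by (simp add: linear_add[OF lin] linear_scale[OF lin] e)
  then show ?thesis by (simp add: algebra_simps)
qed

lemma divergence_deriv_gamma:
  "((\<lambda>s. divergence \<Psi> (\<gamma> s)) has_real_derivative Ddiv (\<gamma> t) (vel t)) (at t)"
  unfolding has_real_derivative_iff_has_vector_derivative
  by (rule has_vector_derivative_along[OF D_div[OF gamma_nonzero] gamma_has_vector_derivative])

text \<open>Continuity, invariance and homogeneity spread the constant to all nonzero points. The
  last step needs \<open>C = 0\<close> or degree \<open>- k - 1 = 0\<close>; then the gradient
  vanishes.\<close>

lemma constant_divergence_imp_harmonic:
  assumes k: "k \<noteq> 1" and C: "\<And>t. 0 < t \<Longrightarrow> t < pi / real g \<Longrightarrow> divergence \<Psi> (\<gamma> t) = C"
    and hom: "C = 0 \<or> k = -1"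
  shows "harmonic \<phi>"
proof -
  have closed: "divergence \<Psi> (\<gamma> t) = C" if "t \<in> {0..pi / real g}" for t
  proof (rule continuous_eq_const_closed_interval[OF _ _ C that])
    show "continuous_on {0..pi / real g} (\<lambda>t. divergence \<Psi> (\<gamma> t))"
      by (intro continuous_at_imp_continuous_on ballI DERIV_isCont[OF divergence_deriv_gamma])
  qed (use g_pos in auto)
  have sphere: "divergence \<Psi> x = C" if x: "norm x = 1" for x
  proof -
    obtain a t where a: "a \<in> carrier G" and t: "t \<in> {0..pi / real g}" and xa: "x = act a (\<gamma> t)"
      using orbit_representation[OF x] by (metis atLeastAtMost_iff)
    show ?thesis
      unfolding xa lin_act(2)[OF a norm_gamma, symmetric] divergence_lin_act[OF a gamma_nonzero]
      by (rule closed[OF t])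
  qed
  have all: "divergence \<Psi> y = C" if y: "y \<noteq> 0" for y
  proof -
    have n: "norm (y /\<^sub>R norm y) = 1" using y by simp
    then have "y /\<^sub>R norm y \<noteq> 0" by auto
    from divergence_homogeneous_ext_scale[OF smooth this, of "norm y" "- k"] y
    have "divergence \<Psi> y = norm y powi (- k - 1) * C" unfolding sphere[OF n] by simp
    then show ?thesis using hom by (elim disjE) simp_all
  qed
  have "Ddiv x v = 0" if x: "norm x = 1" for x v
  proof -
    have "x \<in> - {0}" using x by auto
    then have "(divergence \<Psi> has_derivative (\<lambda>v. 0)) (at x)"
      by (intro has_derivative_transform_within_open[OF has_derivative_const[of C], where s = "- {0}"])
        (simp_all add: all open_Compl)
    from frechet_derivative_at[OF this, symmetric] show ?thesis by simp
  qed
  then show ?thesis unfolding harmonic_iff[OF k] by blast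
qed

text \<open>For \<open>k = 1\<close> the potential gives no information, so the extension of degree
  \<open>1\<close> is taken instead: it is the identity, with constant divergence.\<close>

lemma harmonic_identity:
  assumes "k = 1"
  shows "harmonic \<phi>"
proof -
  have id: "\<phi> x = x" if x: "norm x = 1" for x
  proof -
    obtain a t where "a \<in> carrier G" "x = act a (\<gamma> t)" using orbit_representation[OF x] by metis
    then show ?thesis using phi_act[OF _ norm_gamma] phi_gamma[of t] assms by simp
  qed
  have "homogeneous_ext 1 \<phi> y = y" for y
    by (cases "y = 0") (simp_all add: homogeneous_ext_def id)
  then have F: "homogeneous_ext 1 \<phi> = (\<lambda>y. y)" by auto
  have D: "frechet_derivative (\<lambda>y. y) (at x) = (\<lambda>v. v)" for x :: 'a
    using frechet_derivative_at[OF has_derivative_ident] by metis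
  have "divergence (homogeneous_ext 1 \<phi>) = (\<lambda>x. trace_of (\<lambda>v::'a. v))"
    unfolding F by (simp add: divergence_def[abs_def] D)
  then show ?thesis
    by (subst harmonic_iff_grad_divergence[OF smooth, where r = 1]) (simp_all add: F D inner_commute)
qed

end

theorem theoremC:
  fixes G :: "'g monoid" and T :: "'g topology"
    and A :: "('g set \<times> ('g \<Rightarrow> 'e::euclidean_space)) set"
    and act :: "'g \<Rightarrow> 'a::euclidean_space \<Rightarrow> 'a"
    and \<gamma> :: "real \<Rightarrow> 'a" and \<phi> :: "'a \<Rightarrow> 'a"
    and g m0 m1 n :: nat and j k :: int
  assumes "DIM('a) = n + 2" and "real n = (real m0 + real m1) / 2 * real g"
    and "gmm_action G T A act g m0 m1"
    and "normal_geodesic G act \<gamma>" and "orbit_space_data G act \<gamma> g m0 m1"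
    and "k = j * int g + 1" and "is_k_map G act \<gamma> k \<phi>"
    and "\<not> (g = 1 \<and> k = -1)"
  shows "harmonic \<phi> \<longleftrightarrow> k = 1 \<or> (g = 2 \<and> k = -1) \<or> (m0 = m1 \<and> k = 1 - int g)"
proof -
  interpret k_map_action G T A act \<gamma> \<phi> g m0 m1 n k
    using assms by unfold_locales
  have d: "of_int (1 - k) = of_int (- j) * real g" using assms(6) by simp
  show ?thesis
  proof
    assume h: "harmonic \<phi>"
    show "k = 1 \<or> (g = 2 \<and> k = -1) \<or> (m0 = m1 \<and> k = 1 - int g)"
    \<comment> \<open>For \<open>k = -1\<close> the coefficient \<open>2 - d\<close> vanishes and
      the differential equation no longer forces zeros of the divergence; here
      \<open>j * g = -2\<close> restricts \<open>g\<close> instead.\<close>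
    proof (cases "k = 1 \<or> k = -1")
      case True
      show ?thesis
      proof (cases "k = 1")
        case False
        then have "2 = int g * (- j)" using True assms(6) by (simp add: mult.commute)
        then have "int g dvd 2" by (rule dvdI)
        then have "int g \<le> 2" by (rule zdvd_imp_le) simp
        \<comment> \<open>The value \<open>g = 1\<close> is excluded by assumption: for it the
          profile with \<open>d = 2\<close> is the constant \<open>- m0\<close>, so the map is
          harmonic although none of the alternatives holds.\<close>
        then have "g = 2" using g_pos assms(8) False True by linarith
        then show ?thesis using True False by simp
      qed simp
    next
      case False
      then have k: "k \<noteq> 1" "k \<noteq> -1" by auto
      \<comment> \<open>The integer factor in \<open>d = 1 - k\<close> is \<open>- j\<close>, and
        \<open>- j = 1\<close> means \<open>k = 1 - g\<close>.\<close>
      have "- j = 1 \<and> m0 = m1"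
      proof (rule ode_imp_equal_mult[OF g_pos m_pos d])
        show "- j \<noteq> 0" using k assms(6) by auto
        show "real_of_int (1 - k) \<noteq> 2" using k by simp
        show "divergence \<Psi> (\<gamma> t) = div_profile g m0 m1 (of_int (1 - k)) t"
          if "0 < t" "t < pi / real g" "sin (of_int (1 - k) * t) \<noteq> 0" for t
          by (rule divergence_gamma[OF k(1) that])
        show "((\<lambda>t. divergence \<Psi> (\<gamma> t)) has_real_derivative Ddiv (\<gamma> t) (vel t)) (at t)" for t
          by (rule divergence_deriv_gamma)
        show "(2 - real_of_int (1 - k)) * divergence \<Psi> (\<gamma> t) * sin (real_of_int (1 - k) * t) =
            Ddiv (\<gamma> t) (vel t) * cos (real_of_int (1 - k) * t)" for t
          by (rule harmonic_imp_ode[OF k(1) h])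
      qed
      then show ?thesis using assms(6) by auto
    qed
  next
    assume "k = 1 \<or> (g = 2 \<and> k = -1) \<or> (m0 = m1 \<and> k = 1 - int g)"
    then consider "k = 1" | "k \<noteq> 1" "g = 2" "k = -1" | "k \<noteq> 1" "m0 = m1" "k = 1 - int g" by blast
    then show "harmonic \<phi>"
    proof cases
      case 1
      then show ?thesis by (rule harmonic_identity)
    next
      case 2
      \<comment> \<open>A nonzero constant is admissible here because for \<open>k = -1\<close> the
        divergence has degree \<open>0\<close>.\<close>
      have "divergence \<Psi> (\<gamma> t) = real m1 - real m0" if t: "0 < t" "t < pi / real g" for t
      proof -
        have "sin (2 * t) > 0" using t 2 by (intro sin_gt_zero) (auto simp: field_simps)
        then show ?thesis using divergence_gamma[OF 2(1) t] div_profile_two[of t m0 m1] 2 by simp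
      qed
      then show ?thesis using 2 by (intro constant_divergence_imp_harmonic) auto
    next
      case 3
      have "divergence \<Psi> (\<gamma> t) = 0" if t: "0 < t" "t < pi / real g" for t
      proof -
        have "sin (real g * t) > 0" using t g_pos by (intro sin_gt_zero) (auto simp: field_simps)
        then show ?thesis
          using divergence_gamma[OF 3(1) t] div_profile_equal_mult(1)[of g t m1] 3 by simp
      qed
      then show ?thesis using 3 by (intro constant_divergence_imp_harmonic[where C = 0]) auto
    qed
  qed
qed

end
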